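(* Let $A_{\mathrm{TSP}}$ be a polynomial-time $\alpha$-approximation algorithm for metric TSP. Consider the algorithm that, on a STAR instance $(G,X)$ with $G[X]$ not a star graph: (1) computes a maximal matching $M$ of $G[X]$ and lets $C$ be the set of endpoints of edges of $M$; (2) computes the Hamiltonian cycle $T=A_{\mathrm{TSP}}(C,d_G)$ of the complete graph on $C$; (3) outputs the cycle $S=S_1\circ\cdots\circ S_k$ of $G$, where $T=\langle t_1,\dots,t_k,t_{k+1}=t_1\rangle$ and $S_i$ is a shortest path in $G$ from $t_i$ to $t_{i+1}$. Then this algorithm runs in polynomial time, outputs a cycle of $G$ covering $X$, and is a $3\alpha$-approximation algorithm for STAR on such instances.
   Context: STAR (optimization version): given a simple graph $G=(V,E)$ and non-empty $X\subseteq E$, find a minimum-length cycle, not necessarily simple (a closed walk, possibly a single vertex of length $0$; length counts edges with repetitions), that covers $X$, i.e. every edge of $X$ has an endpoint among the cycle's vertices. $G[X]$ is the subgraph induced by the edge set $X$; a star graph is $K_{1,n}$, $n\ge 1$. $d_G$ is the shortest-path metric of $G$. Metric TSP: given a finite set with a metric, find a minimum-weight Hamiltonian cycle of the complete graph on it; an $\alpha$-approximation returns a Hamiltonian cycle of weight at most $\alpha$ times the optimum. $S\circ T$ denotes concatenation of walks. *)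

theory Defs
  imports "HOL-Analysis.Analysis" "HOL-Computational_Algebra.Polynomial"
begin

section \<open>Graphs, walks and matchings\<close>

type_synonym 'a graph = "'a set \<times> 'a set set"

definition simple_graph :: "'a graph \<Rightarrow> bool" where
  "simple_graph G \<longleftrightarrow> finite (fst G) \<and> (\<forall>e\<in>snd G. e \<subseteq> fst G \<and> card e = 2)"

definition walk :: "'a graph \<Rightarrow> 'a list \<Rightarrow> bool" where
  "walk G p \<longleftrightarrow> p \<noteq> [] \<and> set p \<subseteq> fst G \<and> successively (\<lambda>u v. {u, v} \<in> snd G) p"

definition walk_length :: "'a list \<Rightarrow> nat" where
  "walk_length p = length p - 1"

definition walk_betw :: "'a graph \<Rightarrow> 'a \<Rightarrow> 'a \<Rightarrow> 'a list \<Rightarrow> bool" where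
  "walk_betw G u v p \<longleftrightarrow> walk G p \<and> hd p = u \<and> last p = v"

text \<open>The distance is meaningful only if a walk from \<open>u\<close> to \<open>v\<close> exists.\<close>

definition graph_dist :: "'a graph \<Rightarrow> 'a \<Rightarrow> 'a \<Rightarrow> nat" where
  "graph_dist G u v = (LEAST n. \<exists>p. walk_betw G u v p \<and> n = walk_length p)"

definition shortest_path :: "'a graph \<Rightarrow> 'a \<Rightarrow> 'a \<Rightarrow> 'a list \<Rightarrow> bool" where
  "shortest_path G u v p \<longleftrightarrow>
     walk_betw G u v p \<and> (\<forall>q. walk_betw G u v q \<longrightarrow> walk_length p \<le> walk_length q)"

definition walk_comp :: "'a list \<Rightarrow> 'a list \<Rightarrow> 'a list" where
  "walk_comp p q = p @ tl q"

definition concat_walks :: "'a list list \<Rightarrow> 'a list" where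
  "concat_walks ps = foldl walk_comp (hd ps) (tl ps)"

definition edge_induced :: "'a set set \<Rightarrow> 'a graph" where
  "edge_induced X = (\<Union>X, X)"

definition star_graph :: "'a graph \<Rightarrow> bool" where
  "star_graph G \<longleftrightarrow> (\<exists>c L. finite L \<and> L \<noteq> {} \<and> c \<notin> L \<and>
     fst G = insert c L \<and> snd G = (\<lambda>l. {c, l}) ` L)"

definition matching :: "'a graph \<Rightarrow> 'a set set \<Rightarrow> bool" where
  "matching G M \<longleftrightarrow> M \<subseteq> snd G \<and> (\<forall>e\<in>M. \<forall>f\<in>M. e \<noteq> f \<longrightarrow> e \<inter> f = {})"

definition maximal_matching :: "'a graph \<Rightarrow> 'a set set \<Rightarrow> bool" where
  "maximal_matching G M \<longleftrightarrow> matching G M \<and> (\<forall>M'. matching G M' \<longrightarrow> M \<subseteq> M' \<longrightarrow> M' = M)"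

section \<open>The problem STAR\<close>

text \<open>A cycle is a closed walk; the one-element list is the cycle of length 0.\<close>

definition cycle :: "'a graph \<Rightarrow> 'a list \<Rightarrow> bool" where
  "cycle G p \<longleftrightarrow> walk G p \<and> hd p = last p"

definition covers :: "'a list \<Rightarrow> 'a set set \<Rightarrow> bool" where
  "covers p X \<longleftrightarrow> (\<forall>e\<in>X. e \<inter> set p \<noteq> {})"

definition star_opt :: "'a graph \<Rightarrow> 'a set set \<Rightarrow> nat" where
  "star_opt G X = (LEAST n. \<exists>p. cycle G p \<and> covers p X \<and> n = walk_length p)"

section \<open>Metric TSP\<close>

text \<open>Hamiltonian cycles of the complete graph on \<open>C\<close> are closed vertex sequences
  \<open>t\<^sub>1, \<dots>, t\<^sub>k, t\<^sub>1\<close>.  For two points this is the degenerate tour \<open>t\<^sub>1, t\<^sub>2, t\<^sub>1\<close>,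
  which is needed because a maximal matching may consist of a single edge.\<close>

definition hamiltonian_cycle :: "'a set \<Rightarrow> 'a list \<Rightarrow> bool" where
  "hamiltonian_cycle C T \<longleftrightarrow>
     (\<exists>ts. ts \<noteq> [] \<and> distinct ts \<and> set ts = C \<and> T = ts @ [hd ts])"

definition tour_weight :: "('a \<Rightarrow> 'a \<Rightarrow> rat) \<Rightarrow> 'a list \<Rightarrow> rat" where
  "tour_weight d T = (\<Sum>i<length T - 1. d (T ! i) (T ! Suc i))"

definition tsp_opt :: "'a set \<Rightarrow> ('a \<Rightarrow> 'a \<Rightarrow> rat) \<Rightarrow> rat" where
  "tsp_opt C d = Min {tour_weight d T |T. hamiltonian_cycle C T}"

text \<open>Instances: the points are listed without repetition in some order, and the metric is
  rational-valued so that it can be written down.\<close>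

type_synonym tsp_instance = "nat list \<times> (nat \<Rightarrow> nat \<Rightarrow> rat)"

definition metric_tsp :: "tsp_instance set" where
  "metric_tsp = {(cs, d). distinct cs \<and> 2 \<le> length cs \<and>
     Metric_space (set cs) (\<lambda>u v. real_of_rat (d u v))}"

section \<open>Polynomial time\<close>

text \<open>The machine model is Jones's WHILE language over binary trees.  To keep the running time
  polynomially related to that of Turing machines also for programs that compute large (shared)
  trees, evaluating an expression is charged with the sizes of all trees that occur as values
  of its subexpressions.\<close>

datatype data = Leaf | Node data data

fun left :: "data \<Rightarrow> data" where
  "left Leaf = Leaf"
| "left (Node a b) = a"

fun right :: "data \<Rightarrow> data" where
  "right Leaf = Leaf"
| "right (Node a b) = b"

definition enc_bool :: "bool \<Rightarrow> data" where
  "enc_bool b = (if b then Node Leaf Leaf else Leaf)"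

datatype expr = Var nat | Const data | Mk expr expr | Fst expr | Snd expr | Eq expr expr

datatype cmd = Assign nat expr | Seq cmd cmd | Cond expr cmd cmd | While expr cmd

type_synonym store = "nat \<Rightarrow> data"

fun eval_expr :: "expr \<Rightarrow> store \<Rightarrow> data" where
  "eval_expr (Var x) s = s x"
| "eval_expr (Const a) s = a"
| "eval_expr (Mk e f) s = Node (eval_expr e s) (eval_expr f s)"
| "eval_expr (Fst e) s = left (eval_expr e s)"
| "eval_expr (Snd e) s = right (eval_expr e s)"
| "eval_expr (Eq e f) s = enc_bool (eval_expr e s = eval_expr f s)"

fun cost :: "expr \<Rightarrow> store \<Rightarrow> nat" where
  "cost (Var x) s = Suc (size (s x))"
| "cost (Const a) s = Suc (size a)"
| "cost (Mk e f) s = cost e s + cost f s + Suc (size (eval_expr (Mk e f) s))"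
| "cost (Fst e) s = cost e s + Suc (size (eval_expr (Fst e) s))"
| "cost (Snd e) s = cost e s + Suc (size (eval_expr (Snd e) s))"
| "cost (Eq e f) s = cost e s + cost f s + Suc (size (eval_expr (Eq e f) s))"

text \<open>\<open>exec c s t s'\<close>: started in store \<open>s\<close>, \<open>c\<close> terminates in store \<open>s'\<close> after time \<open>t\<close>.\<close>

inductive exec :: "cmd \<Rightarrow> store \<Rightarrow> nat \<Rightarrow> store \<Rightarrow> bool" where
  Assign: "exec (Assign x e) s (Suc (cost e s)) (s(x := eval_expr e s))"
| Seq: "exec c1 s t1 s' \<Longrightarrow> exec c2 s' t2 s'' \<Longrightarrow> exec (Seq c1 c2) s (Suc (t1 + t2)) s''"
| CondT: "eval_expr e s \<noteq> Leaf \<Longrightarrow> exec c1 s t s' \<Longrightarrow>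
    exec (Cond e c1 c2) s (Suc (cost e s + t)) s'"
| CondF: "eval_expr e s = Leaf \<Longrightarrow> exec c2 s t s' \<Longrightarrow>
    exec (Cond e c1 c2) s (Suc (cost e s + t)) s'"
| WhileF: "eval_expr e s = Leaf \<Longrightarrow> exec (While e c) s (Suc (cost e s)) s"
| WhileT: "eval_expr e s \<noteq> Leaf \<Longrightarrow> exec c s t1 s' \<Longrightarrow> exec (While e c) s' t2 s'' \<Longrightarrow>
    exec (While e c) s (Suc (cost e s + t1 + t2)) s''"

text \<open>\<open>f\<close> is computed in polynomial time on the inputs \<open>D\<close>, relative to encodings of inputs and
  outputs; variable 0 holds the input and the output.  Nothing is required outside \<open>D\<close>.\<close>

definition polynomial_time_on ::
    "'a set \<Rightarrow> ('a \<Rightarrow> data) \<Rightarrow> ('b \<Rightarrow> data) \<Rightarrow> ('a \<Rightarrow> 'b) \<Rightarrow> bool" where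
  "polynomial_time_on D enc_in enc_out f \<longleftrightarrow>
     (\<exists>c (q :: nat poly). \<forall>x\<in>D. \<exists>t s.
        exec c ((\<lambda>_. Leaf)(0 := enc_in x)) t s \<and> s 0 = enc_out (f x) \<and>
        t \<le> poly q (size (enc_in x)))"

text \<open>Numbers are encoded in binary, least significant bit first.\<close>

fun enc_nat :: "nat \<Rightarrow> data" where
  "enc_nat n = (if n = 0 then Leaf else Node (enc_bool (odd n)) (enc_nat (n div 2)))"

declare enc_nat.simps [simp del]

definition enc_int :: "int \<Rightarrow> data" where
  "enc_int i = Node (enc_bool (i < 0)) (enc_nat (nat \<bar>i\<bar>))"

definition enc_rat :: "rat \<Rightarrow> data" where
  "enc_rat r = Node (enc_int (fst (quotient_of r))) (enc_int (snd (quotient_of r)))"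

fun enc_list :: "('a \<Rightarrow> data) \<Rightarrow> 'a list \<Rightarrow> data" where
  "enc_list enc [] = Leaf"
| "enc_list enc (x # xs) = Node (enc x) (enc_list enc xs)"

fun enc_prod :: "('a \<Rightarrow> data) \<Rightarrow> ('b \<Rightarrow> data) \<Rightarrow> 'a \<times> 'b \<Rightarrow> data" where
  "enc_prod enc1 enc2 (a, b) = Node (enc1 a) (enc2 b)"

text \<open>A TSP instance is given by its list of points and the matrix of their mutual distances.\<close>

fun enc_tsp :: "tsp_instance \<Rightarrow> data" where
  "enc_tsp (cs, d) = Node (enc_list enc_nat cs)
     (enc_list (enc_list enc_rat) (map (\<lambda>u. map (\<lambda>v. d u v) cs) cs))"

definition tsp_approximation :: "real \<Rightarrow> (tsp_instance \<Rightarrow> nat list) \<Rightarrow> bool" where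
  "tsp_approximation \<alpha> A \<longleftrightarrow> (\<forall>(cs, d)\<in>metric_tsp.
     hamiltonian_cycle (set cs) (A (cs, d)) \<and>
     real_of_rat (tour_weight d (A (cs, d))) \<le> \<alpha> * real_of_rat (tsp_opt (set cs) d))"

text \<open>A STAR instance is given by the lists of the vertices, of the edges of \<open>G\<close> and of the edges
  in \<open>X\<close>, in any order, with edges oriented arbitrarily and repetitions allowed.\<close>

type_synonym star_instance = "nat list \<times> (nat \<times> nat) list \<times> (nat \<times> nat) list"

definition undirected :: "(nat \<times> nat) list \<Rightarrow> nat set set" where
  "undirected es = (\<lambda>(u, v). {u, v}) ` set es"

fun star_G :: "star_instance \<Rightarrow> nat graph" where
  "star_G (vs, es, xs) = (set vs, undirected es)"

fun star_X :: "star_instance \<Rightarrow> nat set set" where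
  "star_X (vs, es, xs) = undirected xs"

definition enc_star :: "star_instance \<Rightarrow> data" where
  "enc_star = enc_prod (enc_list enc_nat)
     (enc_prod (enc_list (enc_prod enc_nat enc_nat)) (enc_list (enc_prod enc_nat enc_nat)))"

text \<open>\<open>G\<close> may be disconnected; only instances without any feasible solution (those in which \<open>X\<close>
  meets several components of \<open>G\<close>) are excluded.\<close>

definition star_instances :: "star_instance set" where
  "star_instances = {I. simple_graph (star_G I) \<and> star_X I \<noteq> {} \<and> star_X I \<subseteq> snd (star_G I) \<and>
     (\<exists>p. cycle (star_G I) p \<and> covers p (star_X I))}"

definition nonstar_instances :: "star_instance set" where
  "nonstar_instances = {I \<in> star_instances. \<not> star_graph (edge_induced (star_X I))}"

section \<open>The algorithm\<close>

text \<open>\<open>star_algorithm A I S\<close>: \<open>S\<close> is a possible output on \<open>I\<close>.  This is a relation because the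
  matching, the order in which \<open>C\<close> is listed and the shortest paths may be chosen freely.\<close>

definition star_algorithm ::
    "(tsp_instance \<Rightarrow> nat list) \<Rightarrow> star_instance \<Rightarrow> nat list \<Rightarrow> bool" where
  "star_algorithm A I S \<longleftrightarrow> (\<exists>M cs T Ss.
     maximal_matching (edge_induced (star_X I)) M \<and>
     distinct cs \<and> set cs = \<Union>M \<and>
     T = A (cs, \<lambda>u v. of_nat (graph_dist (star_G I) u v)) \<and>
     length Ss = length T - 1 \<and>
     (\<forall>i<length Ss. shortest_path (star_G I) (T ! i) (T ! Suc i) (Ss ! i)) \<and>
     S = concat_walks Ss)"

end

theory Submission
  imports Defs
begin

text \<open>Approximation.  Let \<open>p\<close> be an optimal cycle of length \<open>n\<close>.  The edges of the matching \<open>M\<close> are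
  disjoint and each has an endpoint on \<open>p\<close>; since the instance is not a star, \<open>n > 0\<close>, so \<open>p\<close> has at
  most \<open>n\<close> vertices and \<open>card M \<le> n\<close>.  A detour of length 2 for every edge of \<open>M\<close> turns \<open>p\<close> into a
  closed walk of length at most \<open>3 * n\<close> through all endpoints of \<open>M\<close>, and shortcutting it gives a
  tour of these endpoints of at most that weight.

  Running time.  Functions on trees that are computable in polynomial time are closed under
  composition, pairing, case distinction and primitive recursion on lists with results of
  polynomial size.  Greedy matching, breadth-first search with stored paths, the distance matrix
  in binary and the concatenation of the paths are such recursions.\<close>

section \<open>Programs with subroutines\<close>

text \<open>Two obstacles shape the combinatorial half. The graph may be disconnected and
  \<open>graph_dist\<close> is unspecified across components, so every metric argument takes place
  on the vertices of one closed walk. And \<alpha> is an arbitrary real, so its sign has to be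
  extracted from the guarantee of \<open>A\<close> before the tour bound can be multiplied by it.

  The language has neither procedures nor local variables; a caller therefore keeps its variables
  above those of its subroutines. The time of a run also bounds the growth of every variable,
  because an assignment pays for the tree it stores, and this is what lets polynomial bounds be
  chained.

  The algorithm exists twice: as recursions on arbitrary trees, whose running time needs no
  hypothesis on the input, and as recursions on lists, which carry the correctness proof. Equations
  between encodings connect the two.\<close>

fun expr_bound :: "expr \<Rightarrow> nat" where
  "expr_bound (Var x) = Suc x"
| "expr_bound (Const a) = 0"
| "expr_bound (Mk e f) = max (expr_bound e) (expr_bound f)"
| "expr_bound (Fst e) = expr_bound e"
| "expr_bound (Snd e) = expr_bound e"
| "expr_bound (Eq e f) = max (expr_bound e) (expr_bound f)"

fun cmd_bound :: "cmd \<Rightarrow> nat" where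
  "cmd_bound (Assign x e) = max (Suc x) (expr_bound e)"
| "cmd_bound (Seq c d) = max (cmd_bound c) (cmd_bound d)"
| "cmd_bound (Cond e c d) = max (expr_bound e) (max (cmd_bound c) (cmd_bound d))"
| "cmd_bound (While e c) = max (expr_bound e) (cmd_bound c)"

definition frame :: "nat \<Rightarrow> store \<Rightarrow> store \<Rightarrow> store" where
  "frame N s r = (\<lambda>x. if x < N then s x else r x)"

lemma frame_apply [simp]: "x < N \<Longrightarrow> frame N s r x = s x" "N \<le> x \<Longrightarrow> frame N s r x = r x"
  by (auto simp: frame_def)

lemma frame_upd: "x < N \<Longrightarrow> (frame N s r)(x := v) = frame N (s(x := v)) r"
  "N \<le> x \<Longrightarrow> (frame N s r)(x := v) = frame N s (r(x := v))"
  by (auto simp: frame_def)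

lemma eval_expr_frame:
  "expr_bound e \<le> N \<Longrightarrow> eval_expr e (frame N s r) = eval_expr e s"
  by (induction e) auto

lemma cost_frame:
  "expr_bound e \<le> N \<Longrightarrow> cost e (frame N s r) = cost e s"
  by (induction e) (auto simp: eval_expr_frame)

text \<open>Variables from \<open>N\<close> on are neither read nor written by \<open>c\<close>, so
  its run and its time do not depend on what they hold. With \<open>s\<close> the store of a
  subroutine and \<open>r\<close> that of its caller, this replaces local variables.\<close>

lemma exec_frame:
  "exec c s t s' \<Longrightarrow> cmd_bound c \<le> N \<Longrightarrow> exec c (frame N s r) t (frame N s' r)"
proof (induction rule: exec.induct)
  case (Assign x e s)
  then have "(frame N s r)(x := eval_expr e s) = frame N (s(x := eval_expr e s)) r"
    by (auto simp: frame_def)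
  then show ?case
    using exec.Assign[of x e "frame N s r"] Assign
    by (auto simp: eval_expr_frame cost_frame simp del: fun_upd_apply)
next
  case (Seq c1 s t1 s' c2 t2 s'')
  then show ?case by (auto intro: exec.Seq)
next
  case (CondT e s c1 t s' c2)
  then show ?case
    using exec.CondT[of e "frame N s r" c1 t "frame N s' r" c2] by (simp add: eval_expr_frame cost_frame)
next
  case (CondF e s c2 t s' c1)
  then show ?case
    using exec.CondF[of e "frame N s r" c2 t "frame N s' r" c1] by (simp add: eval_expr_frame cost_frame)
next
  case (WhileF e s c)
  then show ?case
    using exec.WhileF[of e "frame N s r" c] by (simp add: eval_expr_frame cost_frame)
next
  case (WhileT e s c t1 s' t2 s'')
  then show ?case
    using exec.WhileT[of e "frame N s r" c t1 "frame N s' r" t2 "frame N s'' r"]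
    by (simp add: eval_expr_frame cost_frame)
qed

lemma size_eval_expr_le: "size (eval_expr e s) \<le> cost e s"
  by (cases e) auto

text \<open>Storing a tree costs at least its size, so growth is paid for by time. Time bounds thus
  yield size bounds for the inputs of later programs.\<close>

lemma exec_size: "exec c s t s' \<Longrightarrow> size (s' x) \<le> size (s x) + t"
proof (induction rule: exec.induct)
  case (Assign y e s)
  then show ?case using size_eval_expr_le[of e s] by simp
qed auto

section \<open>Execution within a time bound, and subroutine calls\<close>

definition runs :: "cmd \<Rightarrow> store \<Rightarrow> nat \<Rightarrow> store \<Rightarrow> bool" where
  "runs c s T s' \<longleftrightarrow> (\<exists>t\<le>T. exec c s t s')"

lemma runs_mono: "runs c s T s' \<Longrightarrow> T \<le> T' \<Longrightarrow> runs c s T' s'"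
  unfolding runs_def by (meson order_trans)

lemma runs_Assign:
  assumes "s' = s(x := eval_expr e s)" "Suc (cost e s) \<le> T"
  shows "runs (Assign x e) s T s'"
  using exec.Assign[of x e s] assms unfolding runs_def by blast

lemma runs_Seq: "runs c s T s' \<Longrightarrow> runs d s' U s'' \<Longrightarrow> runs (Seq c d) s (Suc (T + U)) s''"
  unfolding runs_def by (metis exec.Seq add_mono Suc_le_mono)

lemma runs_CondT: "eval_expr e s \<noteq> Leaf \<Longrightarrow> runs c s T s' \<Longrightarrow> runs (Cond e c d) s (Suc (cost e s + T)) s'"
  unfolding runs_def by (metis exec.CondT add_left_mono Suc_le_mono)

lemma runs_CondF: "eval_expr e s = Leaf \<Longrightarrow> runs d s T s' \<Longrightarrow> runs (Cond e c d) s (Suc (cost e s + T)) s'"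
  unfolding runs_def by (metis exec.CondF add_left_mono Suc_le_mono)

lemma runs_WhileF: "eval_expr e s = Leaf \<Longrightarrow> runs (While e c) s (Suc (cost e s)) s"
  unfolding runs_def by (blast intro: exec.WhileF)

lemma runs_WhileT:
  assumes "eval_expr e s \<noteq> Leaf" "runs c s T s'" "runs (While e c) s' U s''"
  shows "runs (While e c) s (Suc (cost e s + T + U)) s''"
proof -
  obtain t u where "t \<le> T" "u \<le> U" "exec c s t s'" "exec (While e c) s' u s''"
    using assms unfolding runs_def by blast
  then show ?thesis
    unfolding runs_def using exec.WhileT[OF assms(1)] by (intro exI[of _ "Suc (cost e s + t + u)"]) auto
qed

text \<open>\<open>computes\<close> speaks about runs from a store that is empty except for variable
  0, so a call first erases what earlier calls left behind. The base case assigns to variable 0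
  because there is no command that does nothing.\<close>

fun reset :: "nat \<Rightarrow> cmd" where
  "reset 0 = Assign 0 (Const Leaf)"
| "reset (Suc n) = Seq (Assign n (Const Leaf)) (reset n)"

lemma runs_reset_aux:
  "runs (reset n) s (3 * n + 2) (\<lambda>x. if x < n \<or> x = 0 then Leaf else s x)"
proof (induction n arbitrary: s)
  case 0
  show ?case unfolding reset.simps by (rule runs_Assign) auto
next
  case (Suc n)
  have *: "(\<lambda>x. if x < n \<or> x = 0 then Leaf else (s(n := Leaf)) x) =
      (\<lambda>x. if x < Suc n \<or> x = 0 then Leaf else s x)" by (auto simp: less_Suc_eq)
  have 1: "runs (reset n) (s(n := Leaf)) (3 * n + 2) (\<lambda>x. if x < Suc n \<or> x = 0 then Leaf else s x)"
    using Suc[of "s(n := Leaf)"] unfolding * .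
  have "runs (Assign n (Const Leaf)) s 2 (s(n := Leaf))"
    by (rule runs_Assign) auto
  from runs_mono[OF runs_Seq[OF this 1]] show ?case by simp
qed

lemma runs_reset:
  assumes "0 < N"
  shows "runs (reset N) (frame N s r) (3 * N + 2) (frame N (\<lambda>_. Leaf) r)"
proof -
  have "(\<lambda>x. if x < N \<or> x = 0 then Leaf else frame N s r x) = frame N (\<lambda>_. Leaf) r"
    using assms by (auto simp: frame_def)
  then show ?thesis using runs_reset_aux[of N "frame N s r"] by simp
qed

definition computes :: "cmd \<Rightarrow> data \<Rightarrow> data \<Rightarrow> nat \<Rightarrow> bool" where
  "computes c v w T \<longleftrightarrow> (\<exists>s. runs c ((\<lambda>_. Leaf)(0 := v)) T s \<and> s 0 = w)"

text \<open>A subroutine works on the variables below \<open>N\<close>, the calling program keeps its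
  own variables from \<open>N\<close> on.\<close>

definition call :: "nat \<Rightarrow> cmd \<Rightarrow> expr \<Rightarrow> nat \<Rightarrow> cmd" where
  "call N c e y = Seq (reset N) (Seq (Assign 0 e) (Seq c (Assign y (Var 0))))"

text \<open>The argument \<open>e\<close> is evaluated after the reset and so sees only the caller's
  variables. The time of \<open>c\<close> enters twice: for running it, and for copying a result of
  size at most \<open>size v + T\<close>.\<close>

lemma runs_call:
  assumes "computes c v w T" "cmd_bound c \<le> N" "0 < N" "N \<le> y"
    and "eval_expr e (frame N (\<lambda>_. Leaf) r) = v"
    and "3 * N + 9 + cost e (frame N (\<lambda>_. Leaf) r) + 2 * T + size v \<le> T'"
  shows "\<exists>s'. runs (call N c e y) (frame N s r) T' (frame N s' (r(y := w)))"
proof -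
  obtain s' where s': "runs c ((\<lambda>_. Leaf)(0 := v)) T s'" "s' 0 = w"
    using assms(1) unfolding computes_def by blast
  have 1: "runs (Assign 0 e) (frame N (\<lambda>_. Leaf) r) (Suc (cost e (frame N (\<lambda>_. Leaf) r)))
      (frame N ((\<lambda>_. Leaf)(0 := v)) r)"
    by (rule runs_Assign) (use assms in \<open>auto simp: frame_upd\<close>)
  have 2: "runs c (frame N ((\<lambda>_. Leaf)(0 := v)) r) T (frame N s' r)"
    using s'(1) exec_frame[OF _ assms(2)] unfolding runs_def by blast
  have 3: "runs (Assign y (Var 0)) (frame N s' r) (Suc (Suc (size w))) (frame N s' (r(y := w)))"
    by (rule runs_Assign) (use assms s' in \<open>auto simp: frame_upd\<close>)
  have "size w \<le> size v + T"
    using s' exec_size unfolding runs_def by (metis fun_upd_same add_left_mono order_trans)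
  then show ?thesis
    unfolding call_def
    by (intro exI[of _ s'] runs_mono[OF runs_Seq[OF runs_reset runs_Seq[OF 1 runs_Seq[OF 2 3]]]])
      (use assms in auto)
qed

section \<open>Polynomial bounds and closure properties of polynomial-time functions\<close>

definition poly_bounded :: "(nat \<Rightarrow> nat) \<Rightarrow> bool" where
  "poly_bounded T \<longleftrightarrow> (\<exists>q. \<forall>n. T n \<le> poly q n)"

lemma poly_mono_nat: "m \<le> n \<Longrightarrow> poly q m \<le> poly q (n::nat)"
  by (induction q) (auto intro!: add_mono mult_mono)

lemma poly_bounded_poly: "poly_bounded (poly q)"
  unfolding poly_bounded_def by blast

lemma poly_bounded_const: "poly_bounded (\<lambda>n. k)"
  unfolding poly_bounded_def by (rule exI[of _ "[:k:]"]) simp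

lemma poly_bounded_id: "poly_bounded (\<lambda>n. n)"
  unfolding poly_bounded_def by (rule exI[of _ "[:0, 1:]"]) simp

lemma poly_bounded_add: "poly_bounded T \<Longrightarrow> poly_bounded U \<Longrightarrow> poly_bounded (\<lambda>n. T n + U n)"
  unfolding poly_bounded_def by (metis add_mono poly_add)

lemma poly_bounded_mult: "poly_bounded T \<Longrightarrow> poly_bounded U \<Longrightarrow> poly_bounded (\<lambda>n. T n * U n)"
  unfolding poly_bounded_def by (metis mult_mono' poly_mult zero_le)

lemma poly_bounded_Suc: "poly_bounded T \<Longrightarrow> poly_bounded (\<lambda>n. Suc (T n))"
  using poly_bounded_add[OF _ poly_bounded_const[of 1]] by simp

lemma poly_bounded_comp: "poly_bounded T \<Longrightarrow> poly_bounded (\<lambda>n. poly q (T n))"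
  unfolding poly_bounded_def by (metis poly_mono_nat poly_pcompose)

lemmas poly_bounded_intros =
  poly_bounded_Suc poly_bounded_comp poly_bounded_poly poly_bounded_const poly_bounded_id
  poly_bounded_add poly_bounded_mult

text \<open>With trees as results, encodings and computed functions are the same kind of object, and
  composition becomes transitivity: \<open>f x\<close> from \<open>i x\<close>, then
  \<open>g x\<close> from \<open>f x\<close>. The domain \<open>D\<close> stays a parameter because
  the TSP algorithm is only known to be efficient on \<open>metric_tsp\<close>.\<close>

abbreviation ptime :: "'a set \<Rightarrow> ('a \<Rightarrow> data) \<Rightarrow> ('a \<Rightarrow> data) \<Rightarrow> bool" where
  "ptime D i f \<equiv> polynomial_time_on D i (\<lambda>x. x) f"

lemma ptimeD:
  "ptime D i f \<Longrightarrow> \<exists>c q. \<forall>x\<in>D. computes c (i x) (f x) (poly q (size (i x)))"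
  unfolding polynomial_time_on_def computes_def runs_def by meson

lemma ptimeI:
  assumes "\<And>x. x \<in> D \<Longrightarrow> computes c (i x) (f x) (T (size (i x)))" "poly_bounded T"
  shows "ptime D i f"
proof -
  obtain q where q: "\<And>n. T n \<le> poly q n" using assms(2) unfolding poly_bounded_def by blast
  show ?thesis
    unfolding polynomial_time_on_def
    by (rule exI[of _ c], rule exI[of _ q])
      (use assms(1) q in \<open>unfold computes_def runs_def, meson order_trans\<close>)
qed

lemma computes_size: "computes c v w T \<Longrightarrow> size w \<le> size v + T"
  unfolding computes_def runs_def using exec_size by (metis fun_upd_same add_left_mono order_trans)

lemma ptime_size:
  assumes "ptime D i f"
  shows "\<exists>q. \<forall>x\<in>D. size (f x) \<le> poly q (size (i x))"
proof -
  obtain c q where cq: "\<And>x. x \<in> D \<Longrightarrow> computes c (i x) (f x) (poly q (size (i x)))"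
    using ptimeD[OF assms] by blast
  have "size (f x) \<le> poly ([:0, 1:] + q) (size (i x))" if "x \<in> D" for x
    using computes_size[OF cq[OF that]] by simp
  then show ?thesis by blast
qed

lemma runs_load:
  assumes "0 < N" "N \<le> x"
  shows "runs (Assign x (Var 0)) ((\<lambda>_. Leaf)(0 := v)) (size v + 2)
    (frame N ((\<lambda>_. Leaf)(0 := v)) ((\<lambda>_. Leaf)(x := v)))"
  by (rule runs_Assign) (use assms in \<open>auto simp: frame_def\<close>)

lemma ptime_comp:
  assumes "ptime D i f" "ptime D f g"
  shows "ptime D i g"
proof -
  obtain c q where c: "\<And>x. x \<in> D \<Longrightarrow> computes c (i x) (f x) (poly q (size (i x)))"
    using ptimeD[OF assms(1)] by blast
  obtain d p where d: "\<And>x. x \<in> D \<Longrightarrow> computes d (f x) (g x) (poly p (size (f x)))"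
    using ptimeD[OF assms(2)] by blast
  define N where "N = Suc (max (cmd_bound c) (cmd_bound d))"
  \<comment> \<open>Time of the second program in terms of the original input size \<open>n\<close>:
    its own input \<open>f x\<close> has size at most \<open>n + poly q n\<close>.\<close>
  define P where "P = (\<lambda>n. poly p (n + poly q n))"
  define T where "T = (\<lambda>n. 6 * N + 50 + 100 * (n + poly q n + P n))"
  show ?thesis
  proof (rule ptimeI)
    show "poly_bounded T" unfolding T_def P_def by (intro poly_bounded_intros)
    fix x assume "x \<in> D"
    let ?n = "size (i x)"
    have fs: "size (f x) \<le> ?n + poly q ?n" using computes_size[OF c[OF \<open>x \<in> D\<close>]] .
    have pP: "poly p (size (f x)) \<le> P ?n" using poly_mono_nat[OF fs] by (simp add: P_def)
    have gs: "size (g x) \<le> size (f x) + poly p (size (f x))" using computes_size[OF d[OF \<open>x \<in> D\<close>]] .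
    obtain s1 where s1: "runs (call N c (Var N) N) (frame N ((\<lambda>_. Leaf)(0 := i x)) ((\<lambda>_. Leaf)(N := i x)))
        (3 * N + 10 + 2 * ?n + 2 * poly q ?n) (frame N s1 ((\<lambda>_. Leaf)(N := i x, N := f x)))"
      using runs_call[OF c[OF \<open>x \<in> D\<close>], of N N "Var N" "(\<lambda>_. Leaf)(N := i x)"]
      by (force simp: N_def)
    obtain s2 where s2: "runs (call N d (Var N) N) (frame N s1 ((\<lambda>_. Leaf)(N := i x, N := f x)))
        (3 * N + 10 + 2 * size (f x) + 2 * poly p (size (f x))) (frame N s2 ((\<lambda>_. Leaf)(N := g x)))"
      using runs_call[OF d[OF \<open>x \<in> D\<close>], of N N "Var N" "(\<lambda>_. Leaf)(N := f x)"]
      by (force simp: N_def)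
    have s3: "runs (Assign 0 (Var N)) (frame N s2 ((\<lambda>_. Leaf)(N := g x))) (size (g x) + 2)
        ((frame N s2 ((\<lambda>_. Leaf)(N := g x)))(0 := g x))"
      by (rule runs_Assign) auto
    have "runs (Seq (Assign N (Var 0)) (Seq (call N c (Var N) N) (Seq (call N d (Var N) N) (Assign 0 (Var N)))))
        ((\<lambda>_. Leaf)(0 := i x)) (T ?n) ((frame N s2 ((\<lambda>_. Leaf)(N := g x)))(0 := g x))"
      by (rule runs_mono[OF runs_Seq[OF runs_load runs_Seq[OF s1 runs_Seq[OF s2 s3]]]])
        (use fs pP gs in \<open>auto simp: T_def N_def\<close>)
    then show "computes (Seq (Assign N (Var 0)) (Seq (call N c (Var N) N) (Seq (call N d (Var N) N) (Assign 0 (Var N)))))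
        (i x) (g x) (T ?n)"
      unfolding computes_def by fastforce
  qed
qed

lemma ptime_Node:
  assumes "ptime D i f" "ptime D i g"
  shows "ptime D i (\<lambda>x. Node (f x) (g x))"
proof -
  obtain c q where c: "\<And>x. x \<in> D \<Longrightarrow> computes c (i x) (f x) (poly q (size (i x)))"
    using ptimeD[OF assms(1)] by blast
  obtain d p where d: "\<And>x. x \<in> D \<Longrightarrow> computes d (i x) (g x) (poly p (size (i x)))"
    using ptimeD[OF assms(2)] by blast
  define N where "N = Suc (max (cmd_bound c) (cmd_bound d))"
  define T where "T = (\<lambda>n. 6 * N + 50 + 100 * (n + poly q n + poly p n))"
  show ?thesis
  proof (rule ptimeI)
    show "poly_bounded T" unfolding T_def by (intro poly_bounded_intros)
    fix x assume "x \<in> D"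
    let ?n = "size (i x)"
    let ?r = "(\<lambda>_. Leaf)(N := i x)"
    have fs: "size (f x) \<le> ?n + poly q ?n" using computes_size[OF c[OF \<open>x \<in> D\<close>]] .
    have gs: "size (g x) \<le> ?n + poly p ?n" using computes_size[OF d[OF \<open>x \<in> D\<close>]] .
    obtain s1 where s1: "runs (call N c (Var N) (N+1)) (frame N ((\<lambda>_. Leaf)(0 := i x)) ?r)
        (3 * N + 10 + 2 * ?n + 2 * poly q ?n) (frame N s1 (?r(N+1 := f x)))"
      using runs_call[OF c[OF \<open>x \<in> D\<close>], of N "N+1" "Var N" ?r]
      by (force simp: N_def)
    obtain s2 where s2: "runs (call N d (Var N) (N+2)) (frame N s1 (?r(N+1 := f x)))
        (3 * N + 10 + 2 * ?n + 2 * poly p ?n) (frame N s2 (?r(N+1 := f x, N+2 := g x)))"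
      using runs_call[OF d[OF \<open>x \<in> D\<close>], of N "N+2" "Var N" "?r(N+1 := f x)"]
      by (force simp: N_def)
    let ?s = "frame N s2 (?r(N+1 := f x, N+2 := g x))"
    have s3: "runs (Assign 0 (Mk (Var (N+1)) (Var (N+2)))) ?s (2 * size (f x) + 2 * size (g x) + 5)
        (?s(0 := Node (f x) (g x)))"
      by (rule runs_Assign) auto
    let ?c = "Seq (Assign N (Var 0)) (Seq (call N c (Var N) (N+1)) (Seq (call N d (Var N) (N+2))
        (Assign 0 (Mk (Var (N+1)) (Var (N+2))))))"
    have "runs ?c ((\<lambda>_. Leaf)(0 := i x)) (T ?n) (?s(0 := Node (f x) (g x)))"
      by (rule runs_mono[OF runs_Seq[OF runs_load runs_Seq[OF s1 runs_Seq[OF s2 s3]]]])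
        (use fs gs in \<open>auto simp: T_def N_def\<close>)
    then show "computes ?c (i x) (Node (f x) (g x)) (T ?n)"
      unfolding computes_def by fastforce
  qed
qed


lemma ptime_Assign:
  assumes "\<And>s. eval_expr e s = f (s 0)" "\<And>s. cost e s \<le> 20 * size (s 0) + 20"
  shows "ptime D i (\<lambda>x. f (i x))"
proof (rule ptimeI)
  show "poly_bounded (\<lambda>n. 20 * n + 21)" by (intro poly_bounded_intros)
  fix x
  show "computes (Assign 0 e) (i x) (f (i x)) (20 * size (i x) + 21)"
    unfolding computes_def
    by (rule exI[of _ "(\<lambda>_. Leaf)(0 := f (i x))"], intro conjI runs_Assign)
      (use assms[of "(\<lambda>_. Leaf)(0 := i x)"] in auto)
qed

lemma ptime_id: "ptime D i i"
  using ptime_Assign[of "Var 0" "\<lambda>x. x"] by simp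

lemma ptime_const: "ptime D i (\<lambda>x. a)"
proof (rule ptimeI)
  show "poly_bounded (\<lambda>n. size a + 2)" by (intro poly_bounded_intros)
  fix x
  show "computes (Assign 0 (Const a)) (i x) a (size a + 2)"
    unfolding computes_def
    by (rule exI[of _ "(\<lambda>_. Leaf)(0 := a)"], intro conjI runs_Assign) auto
qed

lemma size_left: "size (left x) \<le> size x" and size_right: "size (right x) \<le> size x"
  by (cases x; simp)+

lemma ptime_left: "ptime D i f \<Longrightarrow> ptime D i (\<lambda>x. left (f x))"
proof (erule ptime_comp, rule ptime_Assign[of "Fst (Var 0)"])
  fix s :: store
  show "cost (Fst (Var 0)) s \<le> 20 * size (s 0) + 20" using size_left[of "s 0"] by simp
qed simp

lemma ptime_right: "ptime D i f \<Longrightarrow> ptime D i (\<lambda>x. right (f x))"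
proof (erule ptime_comp, rule ptime_Assign[of "Snd (Var 0)"])
  fix s :: store
  show "cost (Snd (Var 0)) s \<le> 20 * size (s 0) + 20" using size_right[of "s 0"] by simp
qed simp

lemma ptime_eq:
  assumes "ptime D i f" "ptime D i g"
  shows "ptime D i (\<lambda>x. enc_bool (f x = g x))"
proof -
  let ?h = "\<lambda>d. enc_bool (left d = right d)"
  have "ptime D (\<lambda>x. Node (f x) (g x)) (\<lambda>x. ?h (Node (f x) (g x)))"
  proof (rule ptime_Assign[of "Eq (Fst (Var 0)) (Snd (Var 0))"])
    fix s :: store
    show "cost (Eq (Fst (Var 0)) (Snd (Var 0))) s \<le> 20 * size (s 0) + 20"
      using size_left[of "s 0"] size_right[of "s 0"] by (simp add: enc_bool_def)
  qed simp
  from ptime_comp[OF ptime_Node[OF assms] this] show ?thesis by simp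
qed

text \<open>Both branches are computed before the condition selects one, so case distinction reduces
  to pairing followed by one fixed program on the triple.\<close>

lemma ptime_if:
  assumes "ptime D i (\<lambda>x. enc_bool (b x))" "ptime D i f" "ptime D i g"
  shows "ptime D i (\<lambda>x. if b x then f x else g x)"
proof -
  let ?i = "\<lambda>x. Node (enc_bool (b x)) (Node (f x) (g x))"
  have "ptime D ?i (\<lambda>x. if b x then f x else g x)"
  proof (rule ptimeI)
    show "poly_bounded (\<lambda>n. 20 * n + 20)" by (intro poly_bounded_intros)
    fix x
    let ?s = "(\<lambda>_. Leaf)(0 := ?i x)"
    have T: "runs (Assign 0 (Fst (Snd (Var 0)))) ?s (4 * size (?i x) + 10) (?s(0 := f x))"
      by (rule runs_Assign) auto
    have F: "runs (Assign 0 (Snd (Snd (Var 0)))) ?s (4 * size (?i x) + 10) (?s(0 := g x))"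
      by (rule runs_Assign) auto
    have "runs (Cond (Fst (Var 0)) (Assign 0 (Fst (Snd (Var 0)))) (Assign 0 (Snd (Snd (Var 0)))))
        ?s (20 * size (?i x) + 20) (?s(0 := if b x then f x else g x))"
    proof (cases "b x")
      case True
      have "runs (Cond (Fst (Var 0)) (Assign 0 (Fst (Snd (Var 0)))) (Assign 0 (Snd (Snd (Var 0)))))
        ?s (20 * size (?i x) + 20) (?s(0 := f x))"
        by (rule runs_mono[OF runs_CondT[OF _ T]]) (auto simp: enc_bool_def True)
      then show ?thesis by (simp add: True)
    next
      case False
      have "runs (Cond (Fst (Var 0)) (Assign 0 (Fst (Snd (Var 0)))) (Assign 0 (Snd (Snd (Var 0)))))
        ?s (20 * size (?i x) + 20) (?s(0 := g x))"
        by (rule runs_mono[OF runs_CondF[OF _ F]]) (auto simp: enc_bool_def False)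
      then show ?thesis by (simp add: False)
    qed
    then show "computes (Cond (Fst (Var 0)) (Assign 0 (Fst (Snd (Var 0)))) (Assign 0 (Snd (Snd (Var 0)))))
        (?i x) (if b x then f x else g x) (20 * size (?i x) + 20)"
      unfolding computes_def by fastforce
  qed
  from ptime_comp[OF ptime_Node[OF assms(1) ptime_Node[OF assms(2,3)]] this] show ?thesis .
qed

lemma ptime_not: "ptime D i (\<lambda>x. enc_bool (b x)) \<Longrightarrow> ptime D i (\<lambda>x. enc_bool (\<not> b x))"
proof -
  assume b: "ptime D i (\<lambda>x. enc_bool (b x))"
  have "(\<lambda>x. enc_bool (\<not> b x)) = (\<lambda>x. if b x then enc_bool False else enc_bool True)" by auto
  then show ?thesis using ptime_if[OF b ptime_const ptime_const] by simp
qed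

lemma ptime_conj:
  assumes "ptime D i (\<lambda>x. enc_bool (b x))" "ptime D i (\<lambda>x. enc_bool (b' x))"
  shows "ptime D i (\<lambda>x. enc_bool (b x \<and> b' x))"
proof -
  have "(\<lambda>x. enc_bool (b x \<and> b' x)) = (\<lambda>x. if b x then enc_bool (b' x) else enc_bool False)"
    by auto
  then show ?thesis using ptime_if[OF assms ptime_const[of D i "enc_bool False"]] by simp
qed

section \<open>Primitive recursion on lists\<close>

fun revapp :: "data \<Rightarrow> data \<Rightarrow> data" where
  "revapp Leaf r = r"
| "revapp (Node a s) r = revapp s (Node a r)"

lemma size_revapp: "size (revapp s r) = size s + size r"
  by (induction s r rule: revapp.induct) auto

fun dappend :: "data \<Rightarrow> data \<Rightarrow> data" where
  "dappend Leaf t = t"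
| "dappend (Node a s) t = Node a (dappend s t)"

lemma dappend_Leaf: "dappend s Leaf = s"
  by (induction s) auto

lemma revapp_revapp: "revapp (revapp s r) t = revapp r (dappend s t)"
  by (induction s r arbitrary: t rule: revapp.induct) auto

text \<open>In the main loop, \<open>N\<close> holds the context, \<open>N+1\<close> the suffix
  processed so far, \<open>N+2\<close> the stack of elements still to come, and \<open>N+3\<close>
  the value of the recursion on that suffix.\<close>

definition rec_store :: "nat \<Rightarrow> data \<Rightarrow> data \<Rightarrow> data \<Rightarrow> data \<Rightarrow> store" where
  "rec_store N a b c d = (\<lambda>_. Leaf)(N := a, N+1 := b, N+2 := c, N+3 := d)"

lemma rec_store_simps [simp]:
  "rec_store N a b c d N = a" "rec_store N a b c d (Suc N) = b"
  "rec_store N a b c d (Suc (Suc N)) = c" "rec_store N a b c d (N + 3) = d"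
  "N \<le> y \<Longrightarrow> (frame N s (rec_store N a b c d))(y := v) = frame N s ((rec_store N a b c d)(y := v))"
  "(rec_store N a b c d)(N := v) = rec_store N v b c d"
  "(rec_store N a b c d)(Suc N := v) = rec_store N a v c d"
  "(rec_store N a b c d)(Suc (Suc N) := v) = rec_store N a b v d"
  "(rec_store N a b c d)(N + 3 := v) = rec_store N a b c v"
  unfolding rec_store_def by (auto simp: frame_def)

definition reverse_loop :: "nat \<Rightarrow> cmd" where
  "reverse_loop N = While (Var (N+1)) (Seq (Assign (N+2) (Mk (Fst (Var (N+1))) (Var (N+2))))
     (Assign (N+1) (Snd (Var (N+1)))))"

lemma runs_reverse_loop:
  assumes "size xs + size st \<le> B"
  shows "runs (reverse_loop N) (frame N s (rec_store N c xs st d)) (Suc (size xs) * (20 * B + 20))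
    (frame N s (rec_store N c Leaf (revapp xs st) d))"
  using assms
proof (induction xs arbitrary: st)
  case Leaf
  show ?case
    unfolding reverse_loop_def revapp.simps by (rule runs_mono[OF runs_WhileF]) auto
next
  case (Node a xs)
  let ?s = "frame N s (rec_store N c (Node a xs) st d)"
  let ?s' = "frame N s (rec_store N c (Node a xs) (Node a st) d)"
  let ?s'' = "frame N s (rec_store N c xs (Node a st) d)"
  have 1: "runs (Assign (N+2) (Mk (Fst (Var (N+1))) (Var (N+2)))) ?s (5 * B + 5) ?s'"
    by (rule runs_Assign) (use Node.prems in auto)
  have 2: "runs (Assign (N+1) (Snd (Var (N+1)))) ?s' (5 * B + 5) ?s''"
    by (rule runs_Assign) (use Node.prems in auto)
  have 3: "runs (reverse_loop N) ?s'' (Suc (size xs) * (20 * B + 20))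
      (frame N s (rec_store N c Leaf (revapp xs (Node a st)) d))"
    by (rule Node.IH) (use Node.prems in auto)
  have *: "(20 * B + 20) + Suc (size xs) * (20 * B + 20) \<le> Suc (size (Node a xs)) * (20 * B + 20)"
    by simp
  show ?case
    unfolding reverse_loop_def revapp.simps
    by (rule runs_mono[OF runs_WhileT[OF _ runs_Seq[OF 1 2] 3[unfolded reverse_loop_def]] order_trans[OF _ *]])
      (use Node.prems in auto)
qed

text \<open>Primitive recursion begins at the end of the list, whereas a program takes elements from
  its front. Popping the reversed list rebuilds the suffixes from the shortest one on.\<close>

definition rec_loop :: "nat \<Rightarrow> cmd \<Rightarrow> cmd" where
  "rec_loop N h = While (Var (N+2))
     (Seq (call N h (Mk (Var N) (Mk (Fst (Var (N+2))) (Mk (Var (N+1)) (Var (N+3))))) (N+3))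
     (Seq (Assign (N+1) (Mk (Fst (Var (N+2))) (Var (N+1))))
       (Assign (N+2) (Snd (Var (N+2))))))"

text \<open>Invariant: \<open>N+3\<close> holds \<open>g r\<close> for the suffix \<open>r\<close>
  in \<open>N+1\<close>, and \<open>revapp st r\<close> is the whole list. Restricting
  \<open>h\<close> to arguments that fit into size \<open>L\<close> makes a uniform time
  \<open>T\<close> possible.\<close>

lemma runs_rec_loop:
  assumes "0 < N" "cmd_bound h \<le> N"
    and h: "\<And>a r. size a + size r < L \<Longrightarrow>
      computes h (Node c (Node a (Node r (g r)))) (g (Node a r)) T"
    and B: "size c \<le> B" "L \<le> B" "\<And>r. size r \<le> L \<Longrightarrow> size (g r) \<le> B"
    and "size st + size r \<le> L"
  shows "\<exists>s'. runs (rec_loop N h) (frame N s (rec_store N c r st (g r)))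
    (Suc (size st) * (100 * B + 100 + 3 * N + 2 * T))
    (frame N s' (rec_store N c (revapp st r) Leaf (g (revapp st r))))"
  using assms(7)
proof (induction st arbitrary: r s)
  case Leaf
  show ?case
    unfolding rec_loop_def revapp.simps by (rule exI, rule runs_mono[OF runs_WhileF]) auto
next
  case (Node a st)
  let ?K = "100 * B + 100 + 3 * N + 2 * T"
  let ?s = "frame N s (rec_store N c r (Node a st) (g r))"
  let ?gr = "g (Node a r)"
  have gr: "size (g r) \<le> B" "size ?gr \<le> B" using B(2,3) Node.prems by auto
  have "computes h (Node c (Node a (Node r (g r)))) ?gr T"
    by (rule h) (use Node.prems in auto)
  from runs_call[OF this assms(2,1), of "N+3"
      "Mk (Var N) (Mk (Fst (Var (N+2))) (Mk (Var (N+1)) (Var (N+3))))" "rec_store N c r (Node a st) (g r)"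
      "40 * B + 40 + 3 * N + 2 * T" s]
  obtain s' where s': "runs (call N h (Mk (Var N) (Mk (Fst (Var (N+2))) (Mk (Var (N+1)) (Var (N+3))))) (N+3))
      ?s (40 * B + 40 + 3 * N + 2 * T) (frame N s' (rec_store N c r (Node a st) ?gr))"
    using B(1,2) gr Node.prems by auto
  have 1: "runs (Assign (N+1) (Mk (Fst (Var (N+2))) (Var (N+1))))
      (frame N s' (rec_store N c r (Node a st) ?gr)) (10 * B + 10)
      (frame N s' (rec_store N c (Node a r) (Node a st) ?gr))"
    by (rule runs_Assign) (use Node.prems B(2) in auto)
  have 2: "runs (Assign (N+2) (Snd (Var (N+2))))
      (frame N s' (rec_store N c (Node a r) (Node a st) ?gr)) (10 * B + 10)
      (frame N s' (rec_store N c (Node a r) st ?gr))"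
    by (rule runs_Assign) (use Node.prems B(2) in auto)
  obtain s'' where 3: "runs (rec_loop N h) (frame N s' (rec_store N c (Node a r) st ?gr))
      (Suc (size st) * ?K)
      (frame N s'' (rec_store N c (revapp st (Node a r)) Leaf (g (revapp st (Node a r)))))"
    using Node.IH(2)[of "Node a r" s'] Node.prems by auto
  have *: "?K + Suc (size st) * ?K \<le> Suc (size (Node a st)) * ?K" by simp
  show ?case
    unfolding rec_loop_def revapp.simps
    by (intro exI, rule runs_mono[OF runs_WhileT[OF _ runs_Seq[OF s' runs_Seq[OF 1 2]] 3[unfolded rec_loop_def]]
        order_trans[OF _ *]])
      (use Node.prems B(2) in auto)
qed

abbreviation ptime2 :: "(data \<Rightarrow> data \<Rightarrow> data) \<Rightarrow> bool" where
  "ptime2 g \<equiv> ptime UNIV (\<lambda>x. x) (\<lambda>x. g (left x) (right x))"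

lemma ptime2_comp:
  assumes "ptime2 g" "ptime D i f" "ptime D i h"
  shows "ptime D i (\<lambda>x. g (f x) (h x))"
proof -
  have "ptime D (\<lambda>x. Node (f x) (h x)) (\<lambda>x. g (left (Node (f x) (h x))) (right (Node (f x) (h x))))"
    using assms(1) unfolding polynomial_time_on_def by blast
  from ptime_comp[OF ptime_Node[OF assms(2,3)] this] show ?thesis by simp
qed

lemma ptime2_size:
  assumes "ptime2 g"
  shows "\<exists>q. \<forall>a b. size (g a b) \<le> poly q (Suc (size a + size b))"
proof -
  obtain q where q: "\<And>x. size (g (left x) (right x)) \<le> poly q (size x)"
    using ptime_size[OF assms] by blast
  have "size (g a b) \<le> poly q (Suc (size a + size b))" for a b using q[of "Node a b"] by simp
  then show ?thesis by blast
qed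

text \<open>Trees are read as lists, as in \<open>enc_list\<close>.  The values of \<open>g\<close> on the suffixes of \<open>xs\<close> are the
  intermediate results of the loop that computes \<open>g c xs\<close>, so their sizes must be polynomial.\<close>

lemma ptime2_rec:
  assumes b: "ptime UNIV (\<lambda>x. x) b"
    and h: "ptime UNIV (\<lambda>x. x)
      (\<lambda>x. h (left x) (left (right x)) (left (right (right x))) (right (right (right x))))"
    and g: "\<And>c. g c Leaf = b c" "\<And>c a r. g c (Node a r) = h c a r (g c r)"
    and size: "poly_bounded S" "\<And>c xs. size (g c xs) \<le> S (size c + size xs)"
  shows "ptime2 g"
proof -
  obtain cb qb where cb: "\<And>x. computes cb x (b x) (poly qb (size x))"
    using ptimeD[OF b] by blast
  obtain ch qh where ch': "\<And>x. computes ch x (h (left x) (left (right x)) (left (right (right x)))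
      (right (right (right x)))) (poly qh (size x))"
    using ptimeD[OF h] by blast
  have ch: "computes ch (Node c (Node a (Node r (g c r)))) (g c (Node a r))
      (poly qh (size (Node c (Node a (Node r (g c r))))))" for c a r
    using ch'[of "Node c (Node a (Node r (g c r)))"] by (simp add: g)
  obtain qs where qs: "\<And>n. S n \<le> poly qs n" using size(1) unfolding poly_bounded_def by blast
  define N where "N = Suc (max (cmd_bound cb) (cmd_bound ch))"
  have N: "0 < N" "cmd_bound cb \<le> N" "cmd_bound ch \<le> N" by (auto simp: N_def)
  \<comment> \<open>Context and suffix each have size at most \<open>n\<close>, which bounds the
    values of \<open>g\<close> by \<open>poly qs (2 * n)\<close>. The argument of \<open>h\<close>
    consists of the context, a nonempty suffix split in two, a value of \<open>g\<close> and three
    nodes, hence \<open>3 * B n + 3\<close> in \<open>T\<close>.\<close>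
  define B where "B = (\<lambda>n. n + poly qs (2 * n))"
  define T where "T = (\<lambda>n. poly qh (3 * B n + 3))"
  define U where "U = (\<lambda>n. 200 * (B n + N + 1) + 2 * poly qb n + Suc n * (20 * B n + 20) +
    Suc n * (100 * B n + 100 + 3 * N + 2 * T n))"
  let ?prog = "Seq (Assign N (Fst (Var 0))) (Seq (Assign (N+1) (Snd (Var 0))) (Seq (reverse_loop N)
      (Seq (call N cb (Var N) (N+3)) (Seq (rec_loop N ch) (Assign 0 (Var (N+3)))))))"
  show ?thesis
  proof (rule ptimeI)
    show "poly_bounded U" unfolding U_def T_def B_def by (intro poly_bounded_intros)
    fix x :: data
    define c xs where "c = left x" and "xs = right x"
    let ?n = "size x" and ?B = "B (size x)"
    have n: "size c \<le> ?n" "size xs \<le> ?n" "?n \<le> ?B"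
      by (simp_all add: c_def xs_def size_left size_right B_def)
    have SB: "size (g c r) \<le> ?B" if "size r \<le> ?n" for r
    proof -
      have "size (g c r) \<le> poly qs (size c + size r)" using size(2) qs order_trans by blast
      also have "\<dots> \<le> poly qs (2 * ?n)" by (rule poly_mono_nat) (use that n in simp)
      finally show ?thesis by (simp add: B_def)
    qed
    let ?i = "(\<lambda>_. Leaf)(0 := x)"
    have 1: "runs (Assign N (Fst (Var 0))) ?i (2 * ?B + 3) (frame N ?i (rec_store N c Leaf Leaf Leaf))"
      by (rule runs_Assign) (use n in \<open>auto simp: frame_def rec_store_def N_def c_def\<close>)
    have 2: "runs (Assign (N+1) (Snd (Var 0))) (frame N ?i (rec_store N c Leaf Leaf Leaf)) (2 * ?B + 3)
        (frame N ?i (rec_store N c xs Leaf Leaf))"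
      by (rule runs_Assign) (use n N in \<open>auto simp: xs_def\<close>)
    have 3: "runs (reverse_loop N) (frame N ?i (rec_store N c xs Leaf Leaf))
        (Suc (size xs) * (20 * ?B + 20)) (frame N ?i (rec_store N c Leaf (revapp xs Leaf) Leaf))"
      by (rule runs_reverse_loop) (use n in simp)
    let ?st = "revapp xs Leaf"
    have qbn: "poly qb (size c) \<le> poly qb ?n" using n by (intro poly_mono_nat)
    obtain s1 where 4: "runs (call N cb (Var N) (N+3)) (frame N ?i (rec_store N c Leaf ?st Leaf))
        (3 * N + 10 + 2 * ?B + 2 * poly qb ?n) (frame N s1 (rec_store N c Leaf ?st (g c Leaf)))"
      using runs_call[OF cb, of N "N+3" "Var N" "rec_store N c Leaf ?st Leaf" c
          "3 * N + 10 + 2 * ?B + 2 * poly qb ?n" ?i] n qbn N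
      by (auto simp: g)
    have "\<exists>s'. runs (rec_loop N ch) (frame N s1 (rec_store N c Leaf ?st (g c Leaf)))
        (Suc (size ?st) * (100 * ?B + 100 + 3 * N + 2 * T ?n))
        (frame N s' (rec_store N c (revapp ?st Leaf) Leaf (g c (revapp ?st Leaf))))"
    proof (rule runs_rec_loop[where L = ?n])
      fix a r :: data
      assume ar: "size a + size r < ?n"
      have "size (g c r) \<le> ?B" by (rule SB) (use ar in simp)
      then have "size (Node c (Node a (Node r (g c r)))) \<le> 3 * ?B + 3" using ar n by simp
      then have "poly qh (size (Node c (Node a (Node r (g c r))))) \<le> T ?n"
        unfolding T_def by (rule poly_mono_nat)
      then show "computes ch (Node c (Node a (Node r (g c r)))) (g c (Node a r)) (T ?n)"
        using ch[of c a r] unfolding computes_def by (meson runs_mono)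
    qed (use n SB N in \<open>auto simp: size_revapp\<close>)
    then obtain s2 where 5: "runs (rec_loop N ch) (frame N s1 (rec_store N c Leaf ?st (g c Leaf)))
        (Suc (size xs) * (100 * ?B + 100 + 3 * N + 2 * T ?n))
        (frame N s2 (rec_store N c xs Leaf (g c xs)))"
      by (auto simp: size_revapp revapp_revapp dappend_Leaf)
    let ?s2 = "frame N s2 (rec_store N c xs Leaf (g c xs))"
    have 6: "runs (Assign 0 (Var (N+3))) ?s2 (?B + 2) (?s2(0 := g c xs))"
      by (rule runs_Assign) (use SB n in auto)
    define P Q P' Q' where "P = Suc (size xs) * (20 * ?B + 20)"
      and "Q = Suc (size xs) * (100 * ?B + 100 + 3 * N + 2 * T ?n)"
      and "P' = Suc ?n * (20 * ?B + 20)" and "Q' = Suc ?n * (100 * ?B + 100 + 3 * N + 2 * T ?n)"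
    have "P \<le> P'" "Q \<le> Q'"
      unfolding P_def Q_def P'_def Q'_def using n by (intro mult_mono; simp)+
    moreover have "U ?n = 200 * (?B + N + 1) + 2 * poly qb ?n + P' + Q'"
      unfolding U_def P'_def Q'_def by simp
    ultimately have U: "Suc (2 * ?B + 3 + Suc (2 * ?B + 3 + Suc (P + Suc (3 * N + 10 + 2 * ?B + 2 * poly qb ?n +
        Suc (Q + (?B + 2)))))) \<le> U ?n"
      by simp
    have "runs ?prog ?i (U ?n) (?s2(0 := g c xs))"
      by (intro runs_mono[OF runs_Seq[OF 1 runs_Seq[OF 2 runs_Seq[OF 3 runs_Seq[OF 4 runs_Seq[OF 5 6]]]]]
          U[unfolded P_def Q_def]])
    then show "computes ?prog x (g (left x) (right x)) (U ?n)"
      unfolding computes_def c_def xs_def by fastforce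
  qed
qed

text \<open>If the growth per step does not depend on the accumulator, the total growth is a sum of
  linearly many polynomial terms; repeated doubling is thereby ruled out.\<close>

lemma ptime2_rec_additive:
  assumes b: "ptime UNIV (\<lambda>x. x) b"
    and h: "ptime UNIV (\<lambda>x. x)
      (\<lambda>x. h (left x) (left (right x)) (left (right (right x))) (right (right (right x))))"
    and g: "\<And>c. g c Leaf = b c" "\<And>c a r. g c (Node a r) = h c a r (g c r)"
    and size: "\<And>c a r acc. size (h c a r acc) \<le> size acc + poly q (size c + size a + size r)"
  shows "ptime2 g"
proof -
  obtain p where p: "\<And>c. size (b c) \<le> poly p (size c)" using ptime_size[OF b] by blast
  show ?thesis
  proof (rule ptime2_rec[OF b h g])
    show "poly_bounded (\<lambda>n. poly p n + n * poly q n)" by (intro poly_bounded_intros)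
    fix c xs
    show "size (g c xs) \<le> poly p (size c + size xs) + (size c + size xs) * poly q (size c + size xs)"
    proof -
      have "size (g c ys) \<le> poly p (size c + size xs) + size ys * poly q (size c + size xs)"
        if "size ys \<le> size xs" for ys
        using that
      proof (induction ys)
        case Leaf
        show ?case using p[of c] poly_mono_nat[of "size c" "size c + size xs" p] by (simp add: g)
      next
        case (Node a r)
        have "poly q (size c + size a + size r) \<le> poly q (size c + size xs)"
          by (rule poly_mono_nat) (use Node.prems in simp)
        then show ?case
          using size[of c a r "g c r"] Node.IH(2) Node.prems by (simp add: g(2) algebra_simps)
      qed
      from this[OF order_refl] show ?thesis by (simp add: algebra_simps)
    qed
  qed
qed

lemmas ptime_intros = ptime_if ptime_conj ptime_not ptime_eq ptime_left ptime_right
  ptime_Node ptime_id ptime_const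

section \<open>The algorithm on trees\<close>

fun dmem :: "data \<Rightarrow> data \<Rightarrow> data" where
  "dmem a Leaf = Leaf"
| "dmem a (Node b r) = (if b = a then Node Leaf Leaf else dmem a r)"

lemma ptime2_dmem: "ptime2 dmem"
  by (rule ptime2_rec_additive[where b = "\<lambda>c. Leaf" and q = "[:1:]"
        and h = "\<lambda>c a r acc. if a = c then Node Leaf Leaf else acc"])
    (auto intro!: ptime_intros)

fun dlookup :: "data \<Rightarrow> data \<Rightarrow> data" where
  "dlookup a Leaf = Leaf"
| "dlookup a (Node p r) = (if left p = a then p else dlookup a r)"

lemma ptime2_dlookup: "ptime2 dlookup"
  by (rule ptime2_rec_additive[where b = "\<lambda>c. Leaf" and q = "[:0, 1:]"
        and h = "\<lambda>c a r acc. if left a = c then a else acc"])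
    (auto intro!: ptime_intros)

text \<open>The arguments are exchanged because \<open>ptime2_rec\<close> recurses on the second one
  and treats the first as context.\<close>

lemma ptime2_dappend: "ptime2 (\<lambda>t s. dappend s t)"
  by (rule ptime2_rec_additive[where b = "\<lambda>c. c" and q = "[:1, 1:]"
        and h = "\<lambda>c a r acc. Node a acc"])
    (auto intro!: ptime_intros)

fun dcover :: "data \<Rightarrow> data" where
  "dcover Leaf = Leaf"
| "dcover (Node e r) = (if dmem (left e) (dcover r) = Leaf \<and> dmem (right e) (dcover r) = Leaf
     then Node (left e) (Node (right e) (dcover r)) else dcover r)"

lemma ptime2_dcover: "ptime2 (\<lambda>_. dcover)"
proof (rule ptime2_rec_additive[where b = "\<lambda>c. Leaf" and q = "[:2, 2:]"
        and h = "\<lambda>c a r acc. if dmem (left a) acc = Leaf \<and> dmem (right a) acc = Leaf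
     then Node (left a) (Node (right a) acc) else acc"])
  fix c a r acc :: data
  show "size (if dmem (left a) acc = Leaf \<and> dmem (right a) acc = Leaf
     then Node (left a) (Node (right a) acc) else acc)
    \<le> size acc + poly [:2, 2:] (size c + size a + size r)"
    using size_left[of a] size_right[of a] by simp
qed (auto intro!: ptime_intros ptime2_comp[OF ptime2_dmem])

section \<open>Breadth-first search on trees and the size of its table\<close>

definition drelax :: "data \<Rightarrow> data \<Rightarrow> data \<Rightarrow> data \<Rightarrow> data" where
  "drelax R a b acc = (if dlookup a R \<noteq> Leaf \<and> dlookup b acc = Leaf
     then Node (Node b (dlookup a R)) acc else acc)"

text \<open>Paths to extend are looked up in the table \<open>R\<close> of the previous round,
  vertices already reached in the table under construction. Hence one round lengthens paths by a
  single vertex, and a vertex that has an entry gets no other. Each edge is tried both ways because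
  its orientation in the input is arbitrary.\<close>

fun dstep :: "data \<Rightarrow> data \<Rightarrow> data" where
  "dstep R Leaf = R"
| "dstep R (Node e r) = drelax R (right e) (left e) (drelax R (left e) (right e) (dstep R r))"

lemma size_dlookup: "size (dlookup a R) \<le> size R"
  by (induction R) auto

lemma ptime_drelax:
  assumes "ptime D i R" "ptime D i a" "ptime D i b" "ptime D i acc"
  shows "ptime D i (\<lambda>x. drelax (R x) (a x) (b x) (acc x))"
  unfolding drelax_def by (intro ptime_intros ptime2_comp[OF ptime2_dlookup] assms)

lemma size_drelax: "size (drelax R a b acc) \<le> size acc + size b + size R + 2"
  using size_dlookup[of a R] by (simp add: drelax_def)

lemma ptime2_dstep: "ptime2 dstep"
proof (rule ptime2_rec_additive[where b = "\<lambda>c. c" and q = "[:4, 4:]"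
        and h = "\<lambda>c a r acc. drelax c (right a) (left a) (drelax c (left a) (right a) acc)"])
  fix c a r acc :: data
  show "size (drelax c (right a) (left a) (drelax c (left a) (right a) acc))
    \<le> size acc + poly [:4, 4:] (size c + size a + size r)"
    using size_left[of a] size_right[of a] size_drelax[of c "right a" "left a" "drelax c (left a) (right a) acc"]
      size_drelax[of c "left a" "right a" acc] by simp
qed (auto intro!: ptime_intros ptime_drelax)

fun dbfs :: "data \<Rightarrow> data \<Rightarrow> data" where
  "dbfs c Leaf = Node (Node (left c) Leaf) Leaf"
| "dbfs c (Node v r) = dstep (dbfs c r) (right c)"

fun dlength :: "data \<Rightarrow> nat" where
  "dlength Leaf = 0"
| "dlength (Node a r) = Suc (dlength r)"

fun delems :: "data \<Rightarrow> data set" where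
  "delems Leaf = {}"
| "delems (Node a r) = insert a (delems r)"

lemma dlength_le_size: "dlength d \<le> size d"
  by (induction d) auto

lemma size_le_dlength: "(\<And>a. a \<in> delems d \<Longrightarrow> size a \<le> m) \<Longrightarrow> size d \<le> dlength d * Suc m"
  by (induction d) fastforce+

lemma dlookup_in_delems: "dlookup a R \<noteq> Leaf \<Longrightarrow> dlookup a R \<in> delems R"
  by (induction R) auto

lemma dlength_drelax: "dlength (drelax R a b acc) \<le> Suc (dlength acc)"
  by (simp add: drelax_def)

lemma delems_drelax:
  "p \<in> delems (drelax R a b acc) \<Longrightarrow> p \<in> delems acc \<or> (\<exists>p'\<in>delems R. p = Node b p')"
  using dlookup_in_delems[of a R] by (auto simp: drelax_def split: if_splits)

lemma dlength_dstep: "dlength (dstep R es) \<le> dlength R + 2 * dlength es"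
proof (induction es)
  case (Node e r)
  then show ?case
    using dlength_drelax[of R "right e" "left e" "drelax R (left e) (right e) (dstep R r)"]
      dlength_drelax[of R "left e" "right e" "dstep R r"] by simp
qed simp

lemma delems_dstep:
  assumes "\<And>p. p \<in> delems R \<Longrightarrow> size p \<le> m" "p \<in> delems (dstep R es)"
  shows "size p \<le> m + size es + 1"
  using assms(2)
proof (induction es arbitrary: p)
  case Leaf
  then show ?case using assms(1) by fastforce
next
  case (Node e r)
  then consider "p \<in> delems (dstep R r)" | "\<exists>p'\<in>delems R. p = Node (right e) p'"
    | "\<exists>p'\<in>delems R. p = Node (left e) p'"
    by (auto dest!: delems_drelax)
  then show ?case
  proof cases
    case 1
    then show ?thesis using Node.IH(2) by fastforce
  qed (use assms(1) size_left[of e] size_right[of e] in fastforce)+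
qed

text \<open>A round copies whole paths out of the accumulator, so the additive criterion does not
  apply. Instead the number of entries and the size of the largest entry are bounded separately: a
  round adds at most two entries per edge and raises the maximal entry size by at most
  \<open>?n + 1\<close>. The product of both bounds, with one node per entry, is
  \<open>S\<close>.\<close>

lemma ptime2_dbfs: "ptime2 dbfs"
proof (rule ptime2_rec[where b = "\<lambda>c. Node (Node (left c) Leaf) Leaf"
      and h = "\<lambda>c a r acc. dstep acc (right c)"
      and S = "\<lambda>n. (1 + 2 * (n * n)) * Suc (n + 1 + n * (n + 1))"])
  fix c xs :: data
  let ?n = "size c + size xs"
  have "dlength (dbfs c ys) \<le> 1 + 2 * (dlength ys * ?n) \<and>
    (\<forall>p\<in>delems (dbfs c ys). size p \<le> ?n + 1 + dlength ys * (?n + 1))" for ys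
  proof (induction ys)
    case Leaf
    then show ?case using size_left[of c] by simp
  next
    case (Node a ys)
    have r: "size (right c) \<le> ?n" using size_right[of c] by simp
    have "dlength (right c) \<le> ?n" using dlength_le_size[of "right c"] r by simp
    then have "dlength (dbfs c (Node a ys)) \<le> 1 + 2 * (dlength (Node a ys) * ?n)"
      using dlength_dstep[of "dbfs c ys" "right c"] Node by (simp add: algebra_simps)
    moreover have "size p \<le> ?n + 1 + dlength (Node a ys) * (?n + 1)"
      if "p \<in> delems (dbfs c (Node a ys))" for p
      using delems_dstep[of "dbfs c ys" _ p "right c"] Node that r
      by fastforce
    ultimately show ?case by blast
  qed
  from this[of xs] have 1: "dlength (dbfs c xs) \<le> 1 + 2 * (dlength xs * ?n)" and
    2: "\<And>p. p \<in> delems (dbfs c xs) \<Longrightarrow> size p \<le> ?n + 1 + dlength xs * (?n + 1)"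
    by auto
  have l: "dlength xs \<le> ?n" using dlength_le_size[of xs] by simp
  have "size (dbfs c xs) \<le> dlength (dbfs c xs) * Suc (?n + 1 + dlength xs * (?n + 1))"
    by (rule size_le_dlength[OF 2])
  also have "\<dots> \<le> (1 + 2 * (?n * ?n)) * Suc (?n + 1 + ?n * (?n + 1))"
  proof (rule mult_mono)
    show "dlength (dbfs c xs) \<le> 1 + 2 * (?n * ?n)"
      by (rule order_trans[OF 1]) (intro add_mono mult_mono order_refl l; simp)
    show "Suc (?n + 1 + dlength xs * (?n + 1)) \<le> Suc (?n + 1 + ?n * (?n + 1))"
      using mult_le_mono1[OF l, of "?n + 1"] by simp
  qed auto
  finally show "size (dbfs c xs) \<le> (1 + 2 * (?n * ?n)) * Suc (?n + 1 + ?n * (?n + 1))" .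
qed (auto intro!: ptime_intros ptime2_comp[OF ptime2_dstep] poly_bounded_intros)

section \<open>Binary counting, the distance matrix and concatenation on trees\<close>

fun dsucc :: "data \<Rightarrow> data" where
  "dsucc Leaf = Node (Node Leaf Leaf) Leaf"
| "dsucc (Node b r) = (if b = Leaf then Node (Node Leaf Leaf) r else Node Leaf (dsucc r))"

lemma size_dsucc: "size (dsucc d) \<le> size d + 2"
proof (induction d)
  case (Node b r)
  then show ?case by (cases b) auto
qed simp

lemma ptime2_dsucc: "ptime2 (\<lambda>_. dsucc)"
proof (rule ptime2_rec[where b = "\<lambda>c. Node (Node Leaf Leaf) Leaf" and S = "\<lambda>n. n + 2"
        and h = "\<lambda>c b r acc. if b = Leaf then Node (Node Leaf Leaf) r else Node Leaf acc"])
  fix c xs :: data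
  show "size (dsucc xs) \<le> size c + size xs + 2" using size_dsucc[of xs] by simp
qed (auto intro!: ptime_intros poly_bounded_intros simp del: add_2_eq_Suc')

fun dcount :: "data \<Rightarrow> data" where
  "dcount Leaf = Leaf"
| "dcount (Node a r) = dsucc (dcount r)"

lemma ptime2_dcount: "ptime2 (\<lambda>_. dcount)"
proof (rule ptime2_rec_additive[where b = "\<lambda>c. Leaf" and q = "[:2:]" and h = "\<lambda>c b r acc. dsucc acc"])
  show "ptime UNIV (\<lambda>x. x) (\<lambda>x. dsucc (right (right (right x))))"
    by (intro ptime2_comp[OF ptime2_dsucc, where f = "\<lambda>_. Leaf"] ptime_intros)
qed (use size_dsucc in \<open>auto intro!: ptime_intros\<close>)

fun dmap :: "(data \<Rightarrow> data) \<Rightarrow> data \<Rightarrow> data" where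
  "dmap f Leaf = Leaf"
| "dmap f (Node a r) = Node (f a) (dmap f r)"

lemma ptime2_dmap:
  assumes "ptime2 f"
  shows "ptime2 (\<lambda>c. dmap (f c))"
proof -
  obtain q where q: "\<And>c a. size (f c a) \<le> poly q (Suc (size c + size a))"
    using ptime2_size[OF assms] by blast
  show ?thesis
  proof (rule ptime2_rec_additive[where b = "\<lambda>c. Leaf" and q = "1 + pcompose q [:1, 1:]"
        and h = "\<lambda>c a r acc. Node (f c a) acc"])
    fix c a r acc :: data
    show "size (Node (f c a) acc) \<le> size acc + poly (1 + pcompose q [:1, 1:]) (size c + size a + size r)"
      using q[of c a] poly_mono_nat[of "Suc (size c + size a)" "Suc (size c + size a + size r)" q]
      by (simp add: poly_pcompose)
  qed (auto intro!: ptime_intros ptime2_comp[OF assms])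
qed

text \<open>An entry has the shape of \<open>enc_rat\<close> on a natural number: sign bit false,
  binary digits, denominator 1. Taking \<open>right\<close> drops one vertex of the stored path, so
  that edges are counted.\<close>

definition drow :: "data \<Rightarrow> data \<Rightarrow> data" where
  "drow B = dmap (\<lambda>v. Node (Node Leaf (dcount (right (dlookup v B)))) (enc_int 1))"

lemma ptime2_drow: "ptime2 drow"
  unfolding drow_def
  by (intro ptime2_dmap ptime2_comp[OF ptime2_dcount, where f = "\<lambda>_. Leaf"]
      ptime2_comp[OF ptime2_dlookup] ptime_intros)

text \<open>The context consists of the points, the edges and the vertices.\<close>

definition dmatrix :: "data \<Rightarrow> data \<Rightarrow> data" where
  "dmatrix c = dmap (\<lambda>u. drow (dbfs (Node u (left (right c))) (right (right c))) (left c))"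

lemma ptime2_dmatrix: "ptime2 dmatrix"
  unfolding dmatrix_def
  by (intro ptime2_dmap ptime2_comp[OF ptime2_drow] ptime2_comp[OF ptime2_dbfs] ptime_intros)

text \<open>Stored paths run from the far end back to the source. Searching from the successor of
  \<open>t\<close> and looking up \<open>t\<close> therefore yields a path in the direction of the
  tour.\<close>

fun dconcat :: "data \<Rightarrow> data \<Rightarrow> data" where
  "dconcat c Leaf = Leaf"
| "dconcat c (Node t r) = (if r = Leaf then Node t Leaf
     else dappend (dlookup t (dbfs (Node (left r) (left c)) (right c))) (right (dconcat c r)))"

lemma size_dappend: "size (dappend s t) = size s + size t"
  by (induction s) auto

lemma ptime2_dconcat: "ptime2 dconcat"
proof -
  let ?p = "\<lambda>c t r. dlookup t (dbfs (Node (left r) (left c)) (right c))"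
  have p: "ptime UNIV (\<lambda>x. x) (\<lambda>x. ?p (left x) (left (right x)) (left (right (right x))))"
    by (intro ptime2_comp[OF ptime2_dlookup] ptime2_comp[OF ptime2_dbfs] ptime_intros)
  obtain q where q: "\<And>a b. size (dbfs a b) \<le> poly q (Suc (size a + size b))"
    using ptime2_size[OF ptime2_dbfs] by blast
  show ?thesis
  proof (rule ptime2_rec_additive[where b = "\<lambda>c. Leaf" and q = "[:1, 1:] + pcompose q [:2, 2:]"
        and h = "\<lambda>c t r acc. if r = Leaf then Node t Leaf else dappend (?p c t r) (right acc)"])
    fix c t r acc :: data
    have "size (?p c t r) \<le> size (dbfs (Node (left r) (left c)) (right c))" by (rule size_dlookup)
    also have "\<dots> \<le> poly q (Suc (size (Node (left r) (left c)) + size (right c)))" by (rule q)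
    also have "\<dots> \<le> poly q (2 + 2 * (size c + size t + size r))"
      by (rule poly_mono_nat) (use size_left[of c] size_left[of r] size_right[of c] in simp)
    finally show "size (if r = Leaf then Node t Leaf else dappend (?p c t r) (right acc)) \<le>
        size acc + poly ([:1, 1:] + pcompose q [:2, 2:]) (size c + size t + size r)"
      using size_right[of acc] by (simp add: poly_pcompose size_dappend mult.commute)
  qed (auto intro!: ptime_intros ptime2_comp[OF ptime2_dappend] ptime2_comp[OF ptime2_dlookup]
      ptime2_comp[OF ptime2_dbfs])
qed

section \<open>Walks and tours\<close>

lemma walk_length_Cons: "p \<noteq> [] \<Longrightarrow> walk_length (x # p) = Suc (walk_length p)"
  by (cases p) (auto simp: walk_length_def)

lemma walk_betw_Cons:
  assumes "walk_betw G v w p" "{u, v} \<in> snd G" "u \<in> fst G"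
  shows "walk_betw G u w (u # p)"
  using assms by (auto simp: walk_betw_def walk_def successively_Cons)

lemma walk_betw_append:
  assumes "walk_betw G u v p" "walk_betw G v w q"
  shows "walk_betw G u w (walk_comp p q)" "set (walk_comp p q) = set p \<union> set q"
    "walk_length (walk_comp p q) = walk_length p + walk_length q"
proof -
  obtain q' where q: "q = v # q'"
    using assms(2) by (cases q) (auto simp: walk_betw_def walk_def)
  have p: "p \<noteq> []" "last p = v" using assms(1) by (auto simp: walk_betw_def walk_def)
  show "walk_betw G u w (walk_comp p q)"
    using assms p by (cases q') (auto simp: q walk_betw_def walk_def walk_comp_def successively_append_iff)
  show "set (walk_comp p q) = set p \<union> set q"
    using p by (auto simp: q walk_comp_def)
  show "walk_length (walk_comp p q) = walk_length p + walk_length q"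
    using p by (cases p) (auto simp: q walk_comp_def walk_length_def)
qed

lemma walk_betw_rev:
  assumes "walk_betw G u v p"
  shows "walk_betw G v u (rev p)"
  using assms by (auto simp: walk_betw_def walk_def hd_rev last_rev insert_commute)

lemma graph_dist_le: "walk_betw G u v p \<Longrightarrow> graph_dist G u v \<le> walk_length p"
  unfolding graph_dist_def by (rule Least_le) blast

text \<open>Reversal preserves length, so both minima range over the same set of lengths. This
  includes unconnected vertices, for which both sets are empty.\<close>

lemma graph_dist_commute: "graph_dist G u v = graph_dist G v u"
proof -
  have "(\<exists>p. walk_betw G u v p \<and> n = walk_length p) \<longleftrightarrow> (\<exists>p. walk_betw G v u p \<and> n = walk_length p)" for n
    using walk_betw_rev[of G] by (metis length_rev walk_length_def)
  then show ?thesis by (simp add: graph_dist_def)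
qed

lemma ex_shortest_path:
  assumes "walk_betw G u v q"
  shows "\<exists>p. shortest_path G u v p"
  using ex_has_least_nat[of "walk_betw G u v" q walk_length] assms
  unfolding shortest_path_def by blast

lemma shortest_path_graph_dist:
  assumes "shortest_path G u v p"
  shows "graph_dist G u v = walk_length p"
  unfolding graph_dist_def
  by (rule Least_equality) (use assms in \<open>auto simp: shortest_path_def\<close>)

lemma graph_dist_self: "u \<in> fst G \<Longrightarrow> graph_dist G u u = 0"
  using graph_dist_le[of G u u "[u]"] by (auto simp: walk_betw_def walk_def walk_length_def)

lemma graph_dist_eq_0:
  assumes "walk_betw G u v q" "graph_dist G u v = 0"
  shows "u = v"
proof -
  obtain p where p: "shortest_path G u v p" using ex_shortest_path[OF assms(1)] by blast
  then have "length p - 1 = 0" using shortest_path_graph_dist assms(2) by (metis walk_length_def)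
  moreover have "p \<noteq> []" "hd p = u" "last p = v"
    using p by (auto simp: shortest_path_def walk_betw_def walk_def)
  ultimately show ?thesis by (cases p) auto
qed

text \<open>Walks are assumed because between different components \<open>graph_dist\<close> is the
  \<open>LEAST\<close> of an empty set, about which nothing is known.\<close>

lemma graph_dist_triangle:
  assumes "walk_betw G u v p" "walk_betw G v w q"
  shows "graph_dist G u w \<le> graph_dist G u v + graph_dist G v w"
proof -
  obtain p' q' where p': "shortest_path G u v p'" and q': "shortest_path G v w q'"
    using ex_shortest_path assms by metis
  then have "walk_betw G u v p'" "walk_betw G v w q'" by (auto simp: shortest_path_def)
  from graph_dist_le[OF walk_betw_append(1)[OF this]] walk_betw_append(3)[OF this]
  show ?thesis using shortest_path_graph_dist p' q' by metis
qed

text \<open>The prefix of \<open>p\<close> ending in a vertex leads there from the start; one prefix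
  reversed and another appended join any two vertices. This puts all vertices of a closed walk into
  one component.\<close>

lemma walk_connected:
  assumes "walk G p" "u \<in> set p" "v \<in> set p"
  shows "\<exists>q. walk_betw G u v q"
proof -
  have "\<exists>q. walk_betw G (hd p) x q" if x: "x \<in> set p" for x
  proof -
    obtain ys zs where "p = ys @ x # zs" using x by (meson split_list)
    moreover from this have "walk G (ys @ [x])"
      using assms(1) by (auto simp: walk_def successively_append_iff)
    ultimately have "walk_betw G (hd p) x (ys @ [x])"
      by (cases ys) (auto simp: walk_betw_def)
    then show ?thesis by blast
  qed
  then show ?thesis using assms(2,3) walk_betw_append(1) walk_betw_rev by metis
qed

section \<open>Tour weights and shortcutting\<close>

lemma tour_weight_Nil [simp]: "tour_weight d [] = 0" "tour_weight d [x] = 0"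
  by (simp_all add: tour_weight_def)

lemma tour_weight_Cons: "tour_weight d (x # y # r) = d x y + tour_weight d (y # r)"
  by (simp add: tour_weight_def sum.lessThan_Suc_shift del: sum.lessThan_Suc)

lemma tour_weight_snoc: "ts \<noteq> [] \<Longrightarrow> tour_weight d (ts @ [x]) = tour_weight d ts + d (last ts) x"
proof (induction ts)
  case (Cons t ts)
  then show ?case by (cases ts) (auto simp: tour_weight_Cons)
qed simp

lemma tour_weight_nonneg: "(\<And>u v. 0 \<le> d u v) \<Longrightarrow> 0 \<le> tour_weight d T"
  by (simp add: tour_weight_def sum_nonneg)

lemma dist_ends_le_tour_weight:
  assumes "\<And>x. x \<in> S \<Longrightarrow> d x x = 0"
    and "\<And>x y z. x \<in> S \<Longrightarrow> y \<in> S \<Longrightarrow> z \<in> S \<Longrightarrow> d x z \<le> d x y + d y z"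
    and "q \<noteq> []" "set q \<subseteq> S"
  shows "d (hd q) (last q) \<le> tour_weight d q"
  using assms(3,4)
proof (induction q rule: list_nonempty_induct)
  case (single x)
  then show ?case using assms(1) by simp
next
  case (cons x q)
  obtain y r where q: "q = y # r" using cons by (cases q) auto
  have "d x (last q) \<le> d x y + d y (last q)" using cons by (intro assms(2)) (auto simp: q)
  then show ?case using cons by (auto simp: q tour_weight_Cons)
qed

text \<open>\<open>remdups\<close> keeps last occurrences, so removing the head of \<open>q\<close>
  changes \<open>ts\<close> at most in its head. The two extra terms tie \<open>ts\<close> to the
  ends of \<open>q\<close>: the first carries the induction over skipped vertices, and on a closed
  walk both together pay for the closing edge of the tour.\<close>

lemma tour_weight_shortcut:
  assumes "\<And>x. x \<in> S \<Longrightarrow> d x x = 0"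
    and "\<And>x y z. x \<in> S \<Longrightarrow> y \<in> S \<Longrightarrow> z \<in> S \<Longrightarrow> d x z \<le> d x y + d y z"
    and "set q \<subseteq> S" "ts = remdups (filter (\<lambda>x. x \<in> C) q)" "ts \<noteq> []"
  shows "d (hd q) (hd ts) + tour_weight d ts + d (last ts) (last q) \<le> tour_weight d q"
  using assms(3-5)
proof (induction q arbitrary: ts)
  case (Cons x q)
  show ?case
  proof (cases "x \<in> C \<and> x \<notin> set q")
    case True
    define ts' where "ts' = remdups (filter (\<lambda>x. x \<in> C) q)"
    have ts: "ts = x # ts'" using True Cons.prems(2) by (simp add: ts'_def)
    show ?thesis
    proof (cases "ts' = []")
      case True
      then show ?thesis
        using dist_ends_le_tour_weight[of S d, OF assms(1,2) _ Cons.prems(1)] Cons.prems(1) assms(1)[of x]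
        by (simp add: ts)
    next
      case False
      then obtain y r where q: "q = y # r" by (cases q) (auto simp: ts'_def)
      obtain t r' where t: "ts' = t # r'" using False by (cases ts') auto
      have "t \<in> set q" using arg_cong[OF t, of set] by (auto simp: ts'_def)
      then have "d x t \<le> d x y + d y t" using Cons.prems by (intro assms(2)) (auto simp: q)
      moreover have "d y t + tour_weight d ts' + d (last ts') (last q) \<le> tour_weight d q"
        using Cons.IH[OF _ ts'_def False] Cons.prems(1) by (simp add: q t)
      ultimately show ?thesis
        using assms(1)[of x] Cons.prems(1) by (simp add: ts q t tour_weight_Cons)
    qed
  next
    case False
    then have ts: "ts = remdups (filter (\<lambda>x. x \<in> C) q)" using Cons.prems(2) by auto
    then obtain y r where q: "q = y # r" using Cons.prems(3) by (cases q) auto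
    have "hd ts \<in> set q" using Cons.prems(3) hd_in_set[OF Cons.prems(3)] by (auto simp: ts)
    then have "d x (hd ts) \<le> d x y + d y (hd ts)" using Cons.prems(1) by (intro assms(2)) (auto simp: q)
    then show ?thesis
      using Cons.IH[OF _ ts Cons.prems(3)] Cons.prems(1) by (simp add: q tour_weight_Cons)
  qed
qed simp

lemma finite_hamiltonian_weights: "finite C \<Longrightarrow> finite {tour_weight d T |T. hamiltonian_cycle C T}"
proof -
  assume "finite C"
  then have "finite ((\<lambda>ts. tour_weight d (ts @ [hd ts])) ` {ts. set ts \<subseteq> C \<and> distinct ts})"
    using finite_subset_distinct by blast
  then show ?thesis
    by (rule rev_finite_subset) (auto simp: hamiltonian_cycle_def)
qed

text \<open>The tour visits \<open>C\<close> in the order of last occurrences on \<open>W\<close>.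
  The triangle inequality is required on \<open>S\<close> alone, since graph distances satisfy it
  only within a component.\<close>

lemma tsp_opt_le_closed_walk:
  assumes W: "set W \<subseteq> S" "C \<subseteq> set W" "C \<noteq> {}" "hd W = last W"
    and d: "\<And>x. x \<in> S \<Longrightarrow> d x x = 0"
      "\<And>x y z. x \<in> S \<Longrightarrow> y \<in> S \<Longrightarrow> z \<in> S \<Longrightarrow> d x z \<le> d x y + d y z"
  shows "tsp_opt C d \<le> tour_weight d W"
proof -
  define ts where "ts = remdups (filter (\<lambda>x. x \<in> C) W)"
  have set: "set ts = C" using W by (auto simp: ts_def)
  then have ne: "ts \<noteq> []" "W \<noteq> []" using W by auto
  have "hd ts \<in> S" "last ts \<in> S" "hd W \<in> S"
    using ne hd_in_set[OF ne(1)] last_in_set[OF ne(1)] hd_in_set[OF ne(2)] W(1,2) set by blast+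
  then have "d (last ts) (hd ts) \<le> d (last ts) (last W) + d (hd W) (hd ts)"
    using d(2) W(4) by metis
  then have "tour_weight d (ts @ [hd ts]) \<le> tour_weight d W"
    using tour_weight_shortcut[of S d, OF d W(1) ts_def ne(1)] by (simp add: tour_weight_snoc[OF ne(1)])
  moreover have "hamiltonian_cycle C (ts @ [hd ts])"
    unfolding hamiltonian_cycle_def by (rule exI[of _ ts]) (use ne set in \<open>auto simp: ts_def\<close>)
  moreover have "finite C" using W finite_subset by blast
  ultimately show ?thesis
    unfolding tsp_opt_def
    by (intro order_trans[OF Min_le[OF finite_hamiltonian_weights]]) auto
qed

lemma tour_weight_walk:
  assumes "walk G W"
  shows "tour_weight (\<lambda>u v. of_nat (graph_dist G u v)) W \<le> of_nat (walk_length W)"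
  using assms
proof (induction W)
  case (Cons x W)
  show ?case
  proof (cases W)
    case (Cons y r)
    have "walk G W" "walk_betw G x y [x, y]"
      using Cons.prems by (auto simp: Cons walk_def walk_betw_def)
    then show ?thesis
      using Cons.IH graph_dist_le[of G x y "[x, y]"]
      by (simp add: Cons tour_weight_Cons walk_length_def)
  qed (simp add: walk_length_def)
qed (simp add: walk_length_def)

section \<open>Detours through a matching\<close>

lemma cycle_detour:
  assumes "cycle G W" "a \<in> set W" "{a, b} \<in> snd G" "b \<in> fst G"
  shows "\<exists>W'. cycle G W' \<and> insert b (set W) \<subseteq> set W' \<and> walk_length W' = walk_length W + 2"
proof -
  obtain xs ys where W: "W = xs @ a # ys" using assms(2) by (meson split_list)
  let ?W = "xs @ a # b # a # ys"
  have "walk G ?W"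
    using assms by (auto simp: W cycle_def walk_def successively_append_iff successively_Cons insert_commute)
  then have "cycle G ?W" using assms(1) by (cases xs) (auto simp: W cycle_def)
  moreover have "insert b (set W) \<subseteq> set ?W" "walk_length ?W = walk_length W + 2"
    by (auto simp: W walk_length_def)
  ultimately show ?thesis by blast
qed

lemma cycle_through_matching:
  assumes G: "simple_graph G" and "finite M" "M \<subseteq> snd G" and "cycle G p" "covers p M"
  shows "\<exists>W. cycle G W \<and> set p \<union> \<Union>M \<subseteq> set W \<and> walk_length W \<le> walk_length p + 2 * card M"
  using assms(2-5)
proof (induction M rule: finite_induct)
  case empty
  then show ?case by auto
next
  case (insert e M)
  then obtain W where W: "cycle G W" "set p \<union> \<Union>M \<subseteq> set W" "walk_length W \<le> walk_length p + 2 * card M"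
    by (auto simp: covers_def)
  obtain a where a: "a \<in> e" "a \<in> set W" using insert.prems W(2) by (fastforce simp: covers_def)
  have e: "card e = 2" "e \<subseteq> fst G" using G insert.prems by (auto simp: simple_graph_def)
  then obtain b where b: "e = {a, b}" using a(1) by (auto simp: card_2_iff)
  obtain W' where W': "cycle G W'" "insert b (set W) \<subseteq> set W'" "walk_length W' = walk_length W + 2"
    using cycle_detour[OF W(1) a(2), of b] insert.prems e b by auto
  show ?case
    by (rule exI[of _ W']) (use W W' a b insert.hyps in auto)
qed

text \<open>Choosing a vertex of \<open>p\<close> on every edge of \<open>M\<close> is injective
  because the edges are disjoint.\<close>

lemma card_matching_le:
  assumes "matching G M" "covers p M"
  shows "card M \<le> card (set p)"
proof -
  have "\<forall>e\<in>M. \<exists>x. x \<in> e \<inter> set p" using assms(2) unfolding covers_def by blast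
  then obtain f where f: "\<And>e. e \<in> M \<Longrightarrow> f e \<in> e \<inter> set p" by metis
  have "inj_on f M"
  proof (rule inj_onI)
    fix e e' assume "e \<in> M" "e' \<in> M" "f e = f e'"
    then show "e = e'" using f[of e] f[of e'] assms(1) by (auto simp: matching_def)
  qed
  then show ?thesis using f by (intro card_inj_on_le[of f]) auto
qed

text \<open>Used contrapositively: a covering cycle of length 0 is a single vertex lying on every
  edge of \<open>X\<close>, which would make \<open>X\<close> a star.\<close>

lemma star_graph_single_cover:
  assumes "X \<noteq> {}" "\<And>e. e \<in> X \<Longrightarrow> card e = 2 \<and> c \<in> e" "finite (\<Union>X)"
  shows "star_graph (edge_induced X)"
proof -
  let ?L = "{l. l \<noteq> c \<and> {c, l} \<in> X}"
  have 1: "\<exists>l. e = {c, l} \<and> l \<noteq> c" if "e \<in> X" for e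
    using assms(2)[OF that] by (auto simp: card_2_iff)
  have X: "X = (\<lambda>l. {c, l}) ` ?L" using 1 by auto
  have U: "\<Union>X = insert c ?L"
  proof
    show "\<Union>X \<subseteq> insert c ?L" using 1 by fastforce
    show "insert c ?L \<subseteq> \<Union>X" using assms(1,2) by fastforce
  qed
  have "finite ?L" "?L \<noteq> {}" using assms(1,3) 1 U by auto
  then show ?thesis
    unfolding star_graph_def edge_induced_def
    using X U by (intro exI[of _ c] exI[of _ ?L]) auto
qed

lemma tsp_opt_matching_le:
  assumes G: "simple_graph G" and X: "X \<subseteq> snd G" "X \<noteq> {}" "\<not> star_graph (edge_induced X)"
    and M: "matching (edge_induced X) M" "M \<noteq> {}"
    and p: "cycle G p" "covers p X"
  shows "\<exists>W. cycle G W \<and> \<Union>M \<subseteq> set W"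
    "tsp_opt (\<Union>M) (\<lambda>u v. of_nat (graph_dist G u v)) \<le> of_nat (3 * walk_length p)"
    "0 < walk_length p"
proof -
  have E: "finite (fst G)" "\<And>e. e \<in> snd G \<Longrightarrow> e \<subseteq> fst G \<and> card e = 2"
    using G by (auto simp: simple_graph_def)
  have MX: "M \<subseteq> X" using M by (auto simp: matching_def edge_induced_def)
  have "finite (snd G)"
    by (rule finite_subset[of _ "Pow (fst G)"]) (use E in blast)+
  then have fin: "finite M" using finite_subset[OF subset_trans[OF MX X(1)]] by simp
  have ne: "p \<noteq> []" "hd p = last p" using p by (auto simp: cycle_def walk_def)
  show pos: "0 < walk_length p"
  proof (rule ccontr)
    assume "\<not> 0 < walk_length p"
    then obtain c where "p = [c]" using ne by (cases p) (auto simp: walk_length_def)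
    then have c: "card e = 2 \<and> c \<in> e" if "e \<in> X" for e
      using p(2) E(2)[of e] X(1) that by (auto simp: covers_def)
    have "finite (\<Union>X)" by (rule finite_subset[OF _ E(1)]) (use E X in blast)
    from star_graph_single_cover[OF X(2) c this] X(3) show False by simp
  qed
  \<comment> \<open>A closed walk of positive length repeats its first vertex at the end. Its tail
    thus loses no vertex and has exactly \<open>walk_length p\<close> entries.\<close>
  have "set p = set (tl p)"
    using ne pos by (cases p) (auto simp: walk_length_def)
  then have "card (set p) \<le> walk_length p"
    using card_length[of "tl p"] by (simp add: walk_length_def)
  moreover have "card M \<le> card (set p)"
    using card_matching_le[OF M(1)] p(2) MX by (auto simp: covers_def)
  ultimately have "card M \<le> walk_length p" by simp
  moreover obtain W where W: "cycle G W" "set p \<union> \<Union>M \<subseteq> set W" "walk_length W \<le> walk_length p + 2 * card M"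
    using cycle_through_matching[OF G fin subset_trans[OF MX X(1)] p(1)] p(2) MX
    by (meson covers_def subsetD)
  ultimately have len: "walk_length W \<le> 3 * walk_length p" by simp
  show "\<exists>W. cycle G W \<and> \<Union>M \<subseteq> set W" using W by blast
  have wW: "walk G W" "hd W = last W" using W(1) by (auto simp: cycle_def)
  have "\<Union>M \<noteq> {}" using M(2) MX X E by fastforce
  then have "tsp_opt (\<Union>M) (\<lambda>u v. of_nat (graph_dist G u v))
      \<le> tour_weight (\<lambda>u v. of_nat (graph_dist G u v)) W"
  \<comment> \<open>The vertices of \<open>W\<close> lie in one component, so \<open>set W\<close>
    is a domain on which the triangle inequality holds.\<close>
  proof (intro tsp_opt_le_closed_walk[of W "set W"])
    fix x assume "x \<in> set W"
    then show "of_nat (graph_dist G x x) = (0::rat)"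
      using graph_dist_self[of x G] wW by (auto simp: walk_def)
  next
    fix x y z assume "x \<in> set W" "y \<in> set W" "z \<in> set W"
    then obtain q r where "walk_betw G x y q" "walk_betw G y z r"
      using walk_connected[OF wW(1)] by meson
    from graph_dist_triangle[OF this]
    show "of_nat (graph_dist G x z) \<le> (of_nat (graph_dist G x y) + of_nat (graph_dist G y z) :: rat)"
      by (metis of_nat_add of_nat_le_iff)
  qed (use W wW in auto)
  also have "\<dots> \<le> of_nat (walk_length W)" by (rule tour_weight_walk[OF wW(1)])
  also have "\<dots> \<le> of_nat (3 * walk_length p)" using len by (simp only: of_nat_le_iff)
  finally show "tsp_opt (\<Union>M) (\<lambda>u v. of_nat (graph_dist G u v)) \<le> of_nat (3 * walk_length p)" .
qed

section \<open>Concatenated paths and the approximation guarantee\<close>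

lemma concat_walks_snoc: "ps \<noteq> [] \<Longrightarrow> concat_walks (ps @ [p]) = walk_comp (concat_walks ps) p"
  by (cases ps) (auto simp: concat_walks_def)

text \<open>Induction from the right matches the \<open>foldl\<close> in
  \<open>concat_walks\<close>. Closedness, coverage of the tour and length are proved together
  because each appeal to \<open>walk_betw_append\<close> needs the ends of the walk built so
  far.\<close>

lemma concat_walks:
  assumes "Ss \<noteq> []" "\<And>i. i < length Ss \<Longrightarrow> walk_betw G (t i) (t (Suc i)) (Ss ! i)"
  shows "walk_betw G (t 0) (t (length Ss)) (concat_walks Ss) \<and> t ` {..length Ss} \<subseteq> set (concat_walks Ss) \<and>
    walk_length (concat_walks Ss) = (\<Sum>i<length Ss. walk_length (Ss ! i))"
  using assms
proof (induction Ss rule: rev_nonempty_induct)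
  case (single s)
  then have s: "walk_betw G (t 0) (t (Suc 0)) s" by simp
  then have "t 0 \<in> set s" "t (Suc 0) \<in> set s"
    using hd_in_set[of s] last_in_set[of s] by (auto simp: walk_betw_def walk_def)
  then show ?case using s by (auto simp: concat_walks_def atMost_Suc)
next
  case (snoc s Ss)
  have "walk_betw G (t i) (t (Suc i)) (Ss ! i)" if "i < length Ss" for i
    using snoc.prems[of i] that by (simp add: nth_append)
  then have IH: "walk_betw G (t 0) (t (length Ss)) (concat_walks Ss)" "t ` {..length Ss} \<subseteq> set (concat_walks Ss)"
    "walk_length (concat_walks Ss) = (\<Sum>i<length Ss. walk_length (Ss ! i))"
    using snoc.IH by blast+
  have s: "walk_betw G (t (length Ss)) (t (Suc (length Ss))) s"
    using snoc.prems[of "length Ss"] by simp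
  then have last: "t (Suc (length Ss)) \<in> set s"
    using last_in_set[of s] by (auto simp: walk_betw_def walk_def)
  have sum: "(\<Sum>i<length Ss. walk_length ((Ss @ [s]) ! i)) = (\<Sum>i<length Ss. walk_length (Ss ! i))"
    by (simp add: nth_append)
  note app = walk_betw_append[OF IH(1) s]
  show ?case
    unfolding concat_walks_snoc[OF snoc.hyps] length_append_singleton atMost_Suc
    by (intro conjI) (use app IH(2,3) last sum in auto)
qed

text \<open>An edge avoiding \<Union>M could be added to \<open>M\<close>. By maximality it would
  already belong to \<open>M\<close> and, being nonempty, would meet \<Union>M.\<close>

lemma maximal_matching_covers:
  assumes "maximal_matching (edge_induced X) M" "\<And>e. e \<in> X \<Longrightarrow> e \<noteq> {}" "e \<in> X"
  shows "e \<inter> \<Union>M \<noteq> {}"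
proof
  assume *: "e \<inter> \<Union>M = {}"
  have "matching (edge_induced X) (insert e M)"
    unfolding matching_def
  proof (intro conjI ballI impI)
    show "insert e M \<subseteq> snd (edge_induced X)"
      using assms(1,3) by (simp add: maximal_matching_def matching_def edge_induced_def)
    fix f g assume "f \<in> insert e M" "g \<in> insert e M" "f \<noteq> g"
    then consider "f \<in> M" "g \<in> M" | "f = e" "g \<in> M" | "f \<in> M" "g = e" by blast
    then show "f \<inter> g = {}"
    proof cases
      case 1
      then show ?thesis
        using assms(1) \<open>f \<noteq> g\<close> unfolding maximal_matching_def matching_def by blast
    qed (use * in blast)+
  qed
  then have "insert e M = M" using assms(1) by (auto simp: maximal_matching_def)
  then have "e \<subseteq> \<Union>M" by blast
  then show False using * assms(2)[OF assms(3)] by blast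
qed

text \<open>Points on one cycle lie in one component, where distances are realised by walks; this
  gives definiteness and the triangle inequality.\<close>

lemma Metric_space_graph_dist:
  assumes "cycle G W" "C \<subseteq> set W"
  shows "Metric_space C (\<lambda>u v. real_of_rat (of_nat (graph_dist G u v)))"
proof
  have conn: "\<exists>q. walk_betw G u v q" if "u \<in> C" "v \<in> C" for u v
    using walk_connected[of G W u v] assms that by (auto simp: cycle_def)
  have V: "u \<in> fst G" if "u \<in> C" for u
    using assms that by (auto simp: cycle_def walk_def)
  show "real_of_rat (of_nat (graph_dist G u v)) = real_of_rat (of_nat (graph_dist G v u))" for u v
    by (simp add: graph_dist_commute)
  show "(real_of_rat (of_nat (graph_dist G u v)) = 0) \<longleftrightarrow> u = v" if "u \<in> C" "v \<in> C" for u v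
    using conn[OF that] graph_dist_eq_0[of G u v] graph_dist_self[OF V[OF that(1)]] by auto
  show "real_of_rat (of_nat (graph_dist G u w)) \<le>
      real_of_rat (of_nat (graph_dist G u v)) + real_of_rat (of_nat (graph_dist G v w))"
    if uvw: "u \<in> C" "v \<in> C" "w \<in> C" for u v w
  proof -
    obtain p q where "walk_betw G u v p" "walk_betw G v w q"
      using conn[OF uvw(1,2)] conn[OF uvw(2,3)] by blast
    from graph_dist_triangle[OF this] show ?thesis by simp
  qed
qed simp

text \<open>These facts hold for whatever maximal matching and listing of its endpoints was chosen,
  so they serve both the nondeterministic algorithm and its implementation.\<close>

lemma nonstar_instance:
  assumes I: "I \<in> nonstar_instances" and M: "maximal_matching (edge_induced (star_X I)) M"
    and cs: "distinct cs" "set cs = \<Union>M"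
  shows "(cs, \<lambda>u v. of_nat (graph_dist (star_G I) u v)) \<in> metric_tsp"
    and "tsp_opt (\<Union>M) (\<lambda>u v. of_nat (graph_dist (star_G I) u v)) \<le>
      of_nat (3 * star_opt (star_G I) (star_X I))"
    and "covers cs (star_X I)"
    and "\<exists>W. cycle (star_G I) W \<and> set cs \<subseteq> set W"
proof -
  let ?G = "star_G I" and ?X = "star_X I"
  have G: "simple_graph ?G" and X: "?X \<subseteq> snd ?G" "?X \<noteq> {}" "\<not> star_graph (edge_induced ?X)"
    and ex: "\<exists>p. cycle ?G p \<and> covers p ?X"
    using I by (auto simp: nonstar_instances_def star_instances_def)
  have card2: "card e = 2" if "e \<in> ?X" for e using G X that by (auto simp: simple_graph_def)
  have cov: "e \<inter> \<Union>M \<noteq> {}" if "e \<in> ?X" for e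
    by (rule maximal_matching_covers[OF M _ that]) (use card2 in fastforce)
  then have Mne: "M \<noteq> {}" using X by blast
  have Mm: "matching (edge_induced ?X) M" using M by (simp add: maximal_matching_def)
  show "covers cs ?X" using cov cs by (auto simp: covers_def)
  have "\<exists>p. cycle ?G p \<and> covers p ?X \<and> star_opt ?G ?X = walk_length p"
    unfolding star_opt_def
    by (rule LeastI_ex[of "\<lambda>n. \<exists>p. cycle ?G p \<and> covers p ?X \<and> n = walk_length p"]) (use ex in blast)
  then obtain p where p: "cycle ?G p" "covers p ?X" "star_opt ?G ?X = walk_length p" by blast
  note * = tsp_opt_matching_le[OF G X Mm Mne p(1,2)]
  show "tsp_opt (\<Union>M) (\<lambda>u v. of_nat (graph_dist ?G u v)) \<le> of_nat (3 * star_opt ?G ?X)"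
    using *(2) p(3) by simp
  from *(1) obtain W where W: "cycle ?G W" "\<Union>M \<subseteq> set W" by (elim exE conjE)
  then show "\<exists>W. cycle ?G W \<and> set cs \<subseteq> set W" using cs(2) by auto
  obtain e where e: "e \<in> M" using Mne by blast
  then have "e \<subseteq> set cs" "card e = 2" using cs card2 Mm by (auto simp: matching_def edge_induced_def)
  then have "2 \<le> length cs"
    by (metis List.finite_set card_length card_mono order_trans)
  then show "(cs, \<lambda>u v. of_nat (graph_dist ?G u v)) \<in> metric_tsp"
    using Metric_space_graph_dist[OF W] cs by (auto simp: metric_tsp_def)
qed

lemma star_algorithm_correct:
  assumes A: "tsp_approximation \<alpha> A" and I: "I \<in> nonstar_instances" and S: "star_algorithm A I S"
  shows "cycle (star_G I) S" "covers S (star_X I)"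
    "real (walk_length S) \<le> 3 * \<alpha> * real (star_opt (star_G I) (star_X I))"
proof -
  let ?G = "star_G I" and ?X = "star_X I"
  let ?d = "\<lambda>u v. of_nat (graph_dist ?G u v) :: rat"
  obtain M cs T Ss where M: "maximal_matching (edge_induced ?X) M" and cs: "distinct cs" "set cs = \<Union>M"
    and T: "T = A (cs, ?d)" and Ss: "length Ss = length T - 1"
      "\<And>i. i < length Ss \<Longrightarrow> shortest_path ?G (T ! i) (T ! Suc i) (Ss ! i)" "S = concat_walks Ss"
    using S unfolding star_algorithm_def by blast
  note inst = nonstar_instance[OF I M cs]
  have ham: "hamiltonian_cycle (\<Union>M) T"
    and apx: "real_of_rat (tour_weight ?d T) \<le> \<alpha> * real_of_rat (tsp_opt (\<Union>M) ?d)"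
    using A inst(1) unfolding tsp_approximation_def T cs(2)[symmetric] by blast+
  obtain ts where ts: "ts \<noteq> []" "distinct ts" "set ts = \<Union>M" "T = ts @ [hd ts]"
    using ham by (auto simp: hamiltonian_cycle_def)
  have len: "length Ss = length ts" using Ss(1) ts by simp
  then have "Ss \<noteq> []" using ts by auto
  have cw: "walk_betw ?G (T ! 0) (T ! length Ss) S \<and> (\<lambda>i. T ! i) ` {..length Ss} \<subseteq> set S \<and>
      walk_length S = (\<Sum>i<length Ss. walk_length (Ss ! i))"
    unfolding Ss(3)
    by (rule concat_walks[OF \<open>Ss \<noteq> []\<close>]) (use Ss(2) in \<open>simp add: shortest_path_def\<close>)
  have "T ! 0 = T ! length Ss" using ts len by (simp add: nth_append hd_conv_nth)
  then show "cycle ?G S" using cw by (simp add: walk_betw_def cycle_def)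
  have "\<Union>M \<subseteq> set S"
  proof
    fix x assume "x \<in> \<Union>M"
    then obtain i where "i < length ts" "ts ! i = x" using ts(3) by (metis in_set_conv_nth)
    then have "T ! i = x" "i \<le> length Ss" using ts len by (auto simp: nth_append)
    then show "x \<in> set S" using cw by fastforce
  qed
  then show "covers S ?X" using inst(3) cs(2) by (fastforce simp: covers_def)
  have "walk_length S = (\<Sum>i<length Ss. graph_dist ?G (T ! i) (T ! Suc i))"
    using cw shortest_path_graph_dist[OF Ss(2)] by simp
  then have w: "tour_weight ?d T = of_nat (walk_length S)"
    by (simp add: tour_weight_def Ss(1))
  \<comment> \<open>The sign of \<alpha> is needed to multiply the bound on the TSP optimum by it.
    The output visits at least two points, so its length is positive; since the TSP optimum is
    nonnegative, the guarantee of \<open>A\<close> forces \<alpha> > 0.\<close>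
  have "2 \<le> card (set cs)" using inst(1) by (simp add: metric_tsp_def distinct_card)
  also have "\<dots> \<le> card (set S)" using \<open>\<Union>M \<subseteq> set S\<close> cs by (intro card_mono) auto
  also have "\<dots> \<le> length S" by (rule card_length)
  finally have "0 < walk_length S" by (simp add: walk_length_def)
  have apx': "real (walk_length S) \<le> \<alpha> * real_of_rat (tsp_opt (\<Union>M) ?d)"
    using apx unfolding w by simp
  with \<open>0 < walk_length S\<close> have pos: "0 < \<alpha> * real_of_rat (tsp_opt (\<Union>M) ?d)"
    by (meson less_le_trans of_nat_0_less_iff)
  have "finite (\<Union>M)" unfolding cs(2)[symmetric] by simp
  then have "tsp_opt (\<Union>M) ?d \<in> {tour_weight ?d T |T. hamiltonian_cycle (\<Union>M) T}"
    unfolding tsp_opt_def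
    by (rule Min_in[OF finite_hamiltonian_weights]) (use ham in blast)
  then have "0 \<le> tsp_opt (\<Union>M) ?d"
    by (auto intro!: tour_weight_nonneg)
  then have "0 < \<alpha>" using pos by (metis zero_le_of_rat_iff linorder_not_less mult_nonpos_nonneg)
  have "real (walk_length S) \<le> \<alpha> * real_of_rat (tsp_opt (\<Union>M) ?d)" by (rule apx')
  also have "\<dots> \<le> \<alpha> * real_of_rat (of_nat (3 * star_opt ?G ?X))"
    using inst(2) \<open>0 < \<alpha>\<close> by (intro mult_left_mono) (auto simp: of_rat_less_eq)
  finally show "real (walk_length S) \<le> 3 * \<alpha> * real (star_opt ?G ?X)"
    unfolding of_rat_of_nat_eq by simp
qed

section \<open>The algorithm on lists\<close>

text \<open>The greedy choice proceeds from the end of the list, as the recursion scheme on trees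
  does. Recording endpoints is enough: they decide whether an edge is disjoint from those chosen,
  and they are the points of the TSP instance.\<close>

fun cover :: "('a \<times> 'a) list \<Rightarrow> 'a list" where
  "cover [] = []"
| "cover ((u, v) # xs) = (if u \<notin> set (cover xs) \<and> v \<notin> set (cover xs) then u # v # cover xs else cover xs)"

fun lookup :: "'a \<Rightarrow> 'a list list \<Rightarrow> 'a list" where
  "lookup a [] = []"
| "lookup a (p # R) = (if hd p = a then p else lookup a R)"

definition relax :: "'a list list \<Rightarrow> 'a \<Rightarrow> 'a \<Rightarrow> 'a list list \<Rightarrow> 'a list list" where
  "relax R a b acc =
    (if lookup a R \<noteq> [] \<and> lookup b acc = [] then (b # lookup a R) # acc else acc)"

fun step :: "'a list list \<Rightarrow> ('a \<times> 'a) list \<Rightarrow> 'a list list" where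
  "step R [] = R"
| "step R ((a, b) # es) = relax R b a (relax R a b (step R es))"

text \<open>Paths are stored from their far end, which serves as the search key, back to \<open>u\<close>; the
  vertex list only acts as a clock for the number of rounds.\<close>

fun bfs :: "'a \<Rightarrow> ('a \<times> 'a) list \<Rightarrow> 'a list \<Rightarrow> 'a list list" where
  "bfs u es [] = [[u]]"
| "bfs u es (v # vs) = step (bfs u es vs) es"

abbreviation segments :: "('a \<Rightarrow> 'a \<Rightarrow> 'b) \<Rightarrow> 'a list \<Rightarrow> 'b list" where
  "segments f T \<equiv> map2 f T (tl T)"

definition path_to :: "(nat \<times> nat) list \<Rightarrow> nat list \<Rightarrow> nat \<Rightarrow> nat \<Rightarrow> nat list" where
  "path_to es vs t u = lookup t (bfs u es vs)"

section \<open>Correctness of the greedy matching\<close>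

lemma cover_matching:
  assumes "\<forall>(u, v)\<in>set xs. u \<noteq> v"
  shows "distinct (cover xs) \<and> (\<exists>M. M \<subseteq> undirected xs \<and> (\<forall>e\<in>M. \<forall>f\<in>M. e \<noteq> f \<longrightarrow> e \<inter> f = {}) \<and>
    set (cover xs) = \<Union>M \<and> (\<forall>e\<in>undirected xs. e \<inter> \<Union>M \<noteq> {}))"
  using assms
proof (induction xs)
  case Nil
  then show ?case by (auto simp: undirected_def intro!: exI[of _ "{}"])
next
  case (Cons e xs)
  obtain u v where e: "e = (u, v)" by (cases e)
  have X: "undirected ((u, v) # xs) = insert {u, v} (undirected xs)" by (simp add: undirected_def)
  have prem: "\<forall>(u, v)\<in>set xs. u \<noteq> v" using Cons.prems by simp
  note dist = conjunct1[OF Cons.IH[OF prem]]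
  from conjunct2[OF Cons.IH[OF prem]] obtain M where M: "M \<subseteq> undirected xs"
    "\<forall>e\<in>M. \<forall>f\<in>M. e \<noteq> f \<longrightarrow> e \<inter> f = {}"
    "set (cover xs) = \<Union>M" "\<forall>e\<in>undirected xs. e \<inter> \<Union>M \<noteq> {}"
    by (elim exE conjE)
  show ?case
  proof (cases "u \<notin> \<Union>M \<and> v \<notin> \<Union>M")
    case True
    have "u \<noteq> v" using Cons.prems e by simp
    moreover have "e' \<inter> f = {}" if "e' \<in> insert {u, v} M" "f \<in> insert {u, v} M" "e' \<noteq> f" for e' f
      using that bspec[OF bspec[OF M(2)], of e' f] True by auto
    moreover have "e' \<inter> \<Union>(insert {u, v} M) \<noteq> {}" if "e' \<in> undirected ((u, v) # xs)" for e'
      using that bspec[OF M(4), of e'] unfolding X by auto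
    ultimately show ?thesis
      using True M(1,3) dist unfolding e X by (intro conjI exI[of _ "insert {u, v} M"]) auto
  next
    case False
    then have "cover (e # xs) = cover xs" using M(3) by (auto simp: e)
    moreover have "e' \<inter> \<Union>M \<noteq> {}" if "e' \<in> undirected ((u, v) # xs)" for e'
      using that bspec[OF M(4), of e'] False unfolding X by auto
    ultimately show ?thesis
      using M dist unfolding e X by (intro conjI exI[of _ M]) auto
  qed
qed

lemma cover_maximal_matching:
  assumes "\<And>e. e \<in> undirected xs \<Longrightarrow> card e = 2"
  shows "distinct (cover xs)"
    and "\<exists>M. maximal_matching (edge_induced (undirected xs)) M \<and> set (cover xs) = \<Union>M"
proof -
  have "\<forall>(u, v)\<in>set xs. u \<noteq> v"
    using assms by (force simp: undirected_def)
  note * = cover_matching[of xs, OF this]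
  show "distinct (cover xs)" using conjunct1[OF *] .
  from conjunct2[OF *] obtain M where M: "M \<subseteq> undirected xs" "\<forall>e\<in>M. \<forall>f\<in>M. e \<noteq> f \<longrightarrow> e \<inter> f = {}"
    "set (cover xs) = \<Union>M" "\<forall>e\<in>undirected xs. e \<inter> \<Union>M \<noteq> {}"
    by (elim exE conjE)
  have "M' = M" if M': "matching (edge_induced (undirected xs)) M'" "M \<subseteq> M'" for M'
  proof (rule ccontr)
    assume "M' \<noteq> M"
    then obtain e where e: "e \<in> M'" "e \<notin> M" using M'(2) by blast
    then have "e \<in> undirected xs" using M'(1) by (auto simp: matching_def edge_induced_def)
    then have "e \<inter> \<Union>M \<noteq> {}" using M(4) by simp
    then obtain f where f: "f \<in> M" "e \<inter> f \<noteq> {}" by blast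
    then have "f \<in> M'" "e \<noteq> f" using e(2) M'(2) by auto
    then show False using M'(1) e(1) f(2) by (simp add: matching_def)
  qed
  then have "maximal_matching (edge_induced (undirected xs)) M"
    using M(1,2) by (auto simp: maximal_matching_def matching_def edge_induced_def)
  then show "\<exists>M. maximal_matching (edge_induced (undirected xs)) M \<and> set (cover xs) = \<Union>M"
    using M(3) by blast
qed

section \<open>Correctness of breadth-first search\<close>

lemma lookup_in: "lookup a R \<noteq> [] \<Longrightarrow> lookup a R \<in> set R \<and> hd (lookup a R) = a"
  by (induction R) auto

lemma lookup_eq_Nil: "[] \<notin> set R \<Longrightarrow> lookup a R = [] \<longleftrightarrow> a \<notin> hd ` set R"
  by (induction R) auto

lemma set_relax:
  assumes "[] \<notin> set R" "[] \<notin> set acc"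
  shows "set acc \<subseteq> set (relax R a b acc)" "[] \<notin> set (relax R a b acc)"
    "a \<in> hd ` set R \<Longrightarrow> b \<in> hd ` set (relax R a b acc)"
    "p \<in> set (relax R a b acc) \<Longrightarrow> p \<in> set acc \<or> (\<exists>p'\<in>set R. hd p' = a \<and> b \<notin> hd ` set acc \<and> p = b # p')"
  using assms lookup_in[of a R] lookup_eq_Nil[of R a] lookup_eq_Nil[of acc b]
  by (auto simp: relax_def)

text \<open>New entries are described relative to the table \<open>R\<close> before the round, which
  survives in every intermediate table. That a new end vertex has no entry in \<open>R\<close> is
  what makes its path shortest in \<open>bfs_invariant\<close>.\<close>

lemma set_step:
  assumes R: "[] \<notin> set R"
  shows "set R \<subseteq> set (step R es) \<and> [] \<notin> set (step R es) \<and>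
    (\<forall>a b. {a, b} \<in> (\<lambda>(u, v). {u, v}) ` set es \<longrightarrow> a \<in> hd ` set R \<longrightarrow> b \<in> hd ` set (step R es)) \<and>
    (\<forall>p\<in>set (step R es). p \<in> set R \<or>
      (\<exists>p'\<in>set R. \<exists>b. {hd p', b} \<in> (\<lambda>(u, v). {u, v}) ` set es \<and> b \<notin> hd ` set R \<and> p = b # p'))"
proof (induction es)
  case Nil
  then show ?case using R by auto
next
  case (Cons e es)
  obtain a b where e: "e = (a, b)" by (cases e)
  let ?A = "step R es" and ?B = "relax R a b (step R es)" and ?C = "step R (e # es)"
  have C: "?C = relax R b a ?B" by (simp add: e)
  have A: "set R \<subseteq> set ?A" "[] \<notin> set ?A"
    "\<And>a b. {a, b} \<in> (\<lambda>(u, v). {u, v}) ` set es \<Longrightarrow> a \<in> hd ` set R \<Longrightarrow> b \<in> hd ` set ?A"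
    "\<And>p. p \<in> set ?A \<Longrightarrow> p \<in> set R \<or>
      (\<exists>p'\<in>set R. \<exists>b. {hd p', b} \<in> (\<lambda>(u, v). {u, v}) ` set es \<and> b \<notin> hd ` set R \<and> p = b # p')"
    using Cons by blast+
  note B = set_relax[OF R A(2), where a = a and b = b]
  note C' = set_relax[OF R B(2), where a = b and b = a, folded C]
  have E: "(\<lambda>(u, v). {u, v}) ` set (e # es) = insert {a, b} ((\<lambda>(u, v). {u, v}) ` set es)" by (simp add: e)
  show ?case
    unfolding E
  proof (intro conjI allI impI ballI)
    show "set R \<subseteq> set ?C" using A(1) B(1) C'(1) by blast
    show "[] \<notin> set ?C" by (rule C'(2))
    show "d \<in> hd ` set ?C" if cd: "{c, d} \<in> insert {a, b} ((\<lambda>(u, v). {u, v}) ` set es)" "c \<in> hd ` set R" for c d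
    proof -
      consider "c = a" "d = b" | "c = b" "d = a" | "{c, d} \<in> (\<lambda>(u, v). {u, v}) ` set es"
        using cd(1) unfolding insert_iff doubleton_eq_iff by blast
      then show ?thesis
      proof cases
        case 1
        then show ?thesis using subsetD[OF image_mono[OF C'(1)] B(3)] cd(2) by simp
      next
        case 2
        then show ?thesis using C'(3) cd(2) by simp
      next
        case 3
        show ?thesis using subsetD[OF image_mono[OF subset_trans[OF B(1) C'(1)]] A(3)[OF 3 cd(2)]] .
      qed
    qed
    show "p \<in> set R \<or> (\<exists>p'\<in>set R. \<exists>d. {hd p', d} \<in> insert {a, b} ((\<lambda>(u, v). {u, v}) ` set es) \<and>
        d \<notin> hd ` set R \<and> p = d # p')" if p: "p \<in> set ?C" for p
    proof -
      have ins: "{b, a} = {a, b}" by blast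
      consider "p \<in> set ?A" | "\<exists>p'\<in>set R. hd p' = a \<and> b \<notin> hd ` set ?A \<and> p = b # p'"
        | "\<exists>p'\<in>set R. hd p' = b \<and> a \<notin> hd ` set ?B \<and> p = a # p'"
        using C'(4)[OF p] B(4)[of p] by blast
      then show ?thesis
      proof cases
        case 1
        then show ?thesis using A(4)[OF 1] by blast
      next
        case 2
        then obtain p' where "p' \<in> set R" "hd p' = a" "b \<notin> hd ` set ?A" "p = b # p'" by blast
        then show ?thesis using A(1) by (intro disjI2 bexI[of _ p'] exI[of _ b]) auto
      next
        case 3
        then obtain p' where "p' \<in> set R" "hd p' = b" "a \<notin> hd ` set ?B" "p = a # p'" by blast
        then show ?thesis using A(1) B(1) by (intro disjI2 bexI[of _ p'] exI[of _ a]) auto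
      qed
    qed
  qed
qed

text \<open>Cutting out the loop between two occurrences of a vertex would shorten the walk. The
  lemma limits the number of search rounds to the number of vertices.\<close>

lemma shortest_path_distinct:
  assumes "shortest_path G u v p"
  shows "distinct p"
proof (rule ccontr)
  assume "\<not> distinct p"
  then obtain xs ys zs y where p: "p = xs @ [y] @ ys @ [y] @ zs" using not_distinct_decomp by blast
  have "walk_betw G u v (xs @ [y] @ zs)"
    using assms unfolding p shortest_path_def walk_betw_def walk_def
    by (auto simp: successively_append_iff successively_Cons hd_append)
  then have "walk_length p \<le> walk_length (xs @ [y] @ zs)" using assms by (simp add: shortest_path_def)
  then show False by (simp add: p walk_length_def)
qed

text \<open>Soundness and completeness must go together: a path added after \<open>k\<close> rounds
  has length at most \<open>k + 1\<close>, and completeness up to distance \<open>k\<close> excludes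
  any shorter walk from its newly reached end.\<close>

lemma bfs_invariant:
  fixes G :: "nat graph"
  assumes G: "simple_graph G" "snd G = undirected es" and u: "u \<in> fst G"
  shows "[] \<notin> set (bfs u es vs) \<and>
    (\<forall>p\<in>set (bfs u es vs). shortest_path G (hd p) u p \<and> walk_length p \<le> length vs) \<and>
    (\<forall>v q. walk_betw G v u q \<longrightarrow> walk_length q \<le> length vs \<longrightarrow> v \<in> hd ` set (bfs u es vs))"
proof (induction vs)
  case Nil
  have "v = u" if "walk_betw G v u q" "walk_length q \<le> 0" for v q
    using that by (cases q) (auto simp: walk_betw_def walk_def walk_length_def)
  then show ?case
    using u by (auto simp: shortest_path_def walk_betw_def walk_def walk_length_def)
next
  case (Cons x vs)
  let ?R = "bfs u es vs" and ?k = "length vs"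
  have R: "[] \<notin> set ?R" "\<And>p. p \<in> set ?R \<Longrightarrow> shortest_path G (hd p) u p \<and> walk_length p \<le> ?k"
    "\<And>v q. walk_betw G v u q \<Longrightarrow> walk_length q \<le> ?k \<Longrightarrow> v \<in> hd ` set ?R"
    using Cons by blast+
  have E: "(\<lambda>(u, v). {u, v}) ` set es = snd G" using G(2) by (simp add: undirected_def)
  note S = set_step[OF R(1), of es, unfolded E]
  have S1: "set ?R \<subseteq> set (step ?R es)" "[] \<notin> set (step ?R es)" using S by blast+
  have S2: "b \<in> hd ` set (step ?R es)" if "{a, b} \<in> snd G" "a \<in> hd ` set ?R" for a b
    using S that by blast
  have S3: "p \<in> set ?R \<or> (\<exists>p'\<in>set ?R. \<exists>b. {hd p', b} \<in> snd G \<and> b \<notin> hd ` set ?R \<and> p = b # p')"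
    if "p \<in> set (step ?R es)" for p
    using S that by blast
  have "shortest_path G (hd p) u p \<and> walk_length p \<le> Suc ?k" if p: "p \<in> set (step ?R es)" for p
    using S3[OF p]
  proof
    assume "p \<in> set ?R"
    then show ?thesis using R(2) by fastforce
  next
    assume "\<exists>p'\<in>set ?R. \<exists>b. {hd p', b} \<in> snd G \<and> b \<notin> hd ` set ?R \<and> p = b # p'"
    then obtain p' b where p': "p' \<in> set ?R" "{hd p', b} \<in> snd G" "b \<notin> hd ` set ?R" "p = b # p'" by blast
    have w: "walk_betw G (hd p') u p'" "walk_length p' \<le> ?k" "p' \<noteq> []"
      using R(1,2) p'(1) by (auto simp: shortest_path_def)
    have "b \<in> fst G" using G(1) p'(2) by (auto simp: simple_graph_def)
    then have "walk_betw G b u p"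
      unfolding p'(4) using p'(2) w(1) by (intro walk_betw_Cons) (auto simp: insert_commute)
    moreover have "walk_length p \<le> Suc ?k" using w by (simp add: p'(4) walk_length_Cons)
    moreover have "Suc ?k \<le> walk_length q" if "walk_betw G b u q" for q
      using R(3)[OF that] p'(3) by force
    ultimately show ?thesis
      unfolding shortest_path_def by (force simp: p'(4))
  qed
  moreover have "v \<in> hd ` set (step ?R es)" if q: "walk_betw G v u q" "walk_length q \<le> Suc ?k" for v q
  proof (cases "walk_length q \<le> ?k")
    case True
    then show ?thesis using R(3)[OF q(1)] S1 by blast
  next
    case False
    then obtain w r where qr: "q = v # w # r"
      using q(1) by (cases q; cases "tl q") (auto simp: walk_betw_def walk_def walk_length_def)
    then have "walk_betw G w u (w # r)" "{w, v} \<in> snd G" "walk_length (w # r) \<le> ?k"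
      using q by (auto simp: walk_betw_def walk_def walk_length_def insert_commute)
    then show ?thesis using R(3) S2 by blast
  qed
  ultimately show ?case using S1 by simp
qed

text \<open>A shortest path repeats no vertex, so \<open>length vs\<close> rounds reach every vertex
  connected to \<open>u\<close>; a repetition in \<open>vs\<close> only adds a round.\<close>

lemma path_to_shortest:
  assumes G: "simple_graph (set vs, undirected es)" and q: "walk_betw (set vs, undirected es) t u q"
  shows "shortest_path (set vs, undirected es) t u (path_to es vs t u)"
proof -
  let ?G = "(set vs, undirected es)"
  obtain p where p: "shortest_path ?G t u p" using ex_shortest_path[OF q] by blast
  then have w: "walk ?G p" "walk_betw ?G t u p" by (auto simp: shortest_path_def walk_betw_def)
  have "length p = card (set p)" using shortest_path_distinct[OF p] by (simp add: distinct_card)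
  also have "\<dots> \<le> card (set vs)" using w(1) by (intro card_mono) (auto simp: walk_def)
  also have "\<dots> \<le> length vs" by (rule card_length)
  finally have len: "walk_length p \<le> length vs" by (simp add: walk_length_def)
  have "u \<in> set vs" using w(2) last_in_set[of p] by (auto simp: walk_betw_def walk_def)
  then have inv: "[] \<notin> set (bfs u es vs)" "\<And>p. p \<in> set (bfs u es vs) \<Longrightarrow> shortest_path ?G (hd p) u p"
      "t \<in> hd ` set (bfs u es vs)"
    using bfs_invariant[OF G, of es u vs] w(2) len by auto
  then have "lookup t (bfs u es vs) \<noteq> []" using lookup_eq_Nil by metis
  then show ?thesis
    using lookup_in[of t "bfs u es vs"] inv(2) unfolding path_to_def by metis
qed

section \<open>Joining paths along a tour\<close>

fun tour_walk :: "('a \<Rightarrow> 'a \<Rightarrow> 'a list) \<Rightarrow> 'a list \<Rightarrow> 'a list" where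
  "tour_walk f [] = []"
| "tour_walk f (t # r) = (if r = [] then [t] else f t (hd r) @ tl (tour_walk f r))"

text \<open>\<open>tour_walk\<close> builds the result from the right, as \<open>dconcat\<close>
  does, and \<open>concat_walks\<close> from the left; they are compared through the concatenated
  tails. Nonempty paths ensure that \<open>tl\<close> of an append acts on its first part.\<close>

lemma tl_tour_walk:
  assumes "\<And>i. Suc i < length T \<Longrightarrow> f (T ! i) (T ! Suc i) \<noteq> []"
  shows "tl (tour_walk f T) = concat (map tl (segments f T))"
  using assms
proof (induction T)
  case (Cons t r)
  show ?case
  proof (cases r)
    case (Cons t' r')
    have "f t t' \<noteq> []" using Cons.prems[of 0] Cons by simp
    moreover have "tl (tour_walk f r) = concat (map tl (segments f r))"
      by (rule Cons.IH) (use Cons.prems in fastforce)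
    ultimately show ?thesis by (simp add: Cons)
  qed simp
qed simp

lemma foldl_walk_comp: "foldl walk_comp p ps = p @ concat (map tl ps)"
  by (induction ps arbitrary: p) (auto simp: walk_comp_def)

lemma tour_walk_concat_walks:
  assumes "\<And>i. Suc i < length T \<Longrightarrow> f (T ! i) (T ! Suc i) \<noteq> []" "2 \<le> length T"
  shows "tour_walk f T = concat_walks (segments f T)"
proof -
  obtain t t' r where T: "T = t # t' # r"
    using assms(2) by (cases T; cases "tl T") auto
  have "tl (tour_walk f (t' # r)) = concat (map tl (segments f (t' # r)))"
    by (rule tl_tour_walk) (use assms(1)[of "Suc _"] in \<open>simp add: T\<close>)
  then show ?thesis by (simp add: T concat_walks_def foldl_walk_comp)
qed

section \<open>Lists and trees\<close>

lemma enc_nat_simps: "enc_nat 0 = Leaf"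
  "n \<noteq> 0 \<Longrightarrow> enc_nat n = Node (enc_bool (odd n)) (enc_nat (n div 2))"
  by (subst enc_nat.simps; simp)+

lemma enc_bool_eq [simp]: "enc_bool a = enc_bool b \<longleftrightarrow> a = b" "enc_bool a = Leaf \<longleftrightarrow> \<not> a"
  by (auto simp: enc_bool_def)

text \<open>Programs compare vertices as trees, so membership tests and lookups rely on this. A
  number is determined by its parity and its half.\<close>

lemma enc_nat_inj [simp]: "enc_nat m = enc_nat n \<longleftrightarrow> m = n"
proof (induction m arbitrary: n rule: less_induct)
  case (less m)
  show ?case
  proof (cases "m = 0 \<or> n = 0")
    case True
    then show ?thesis by (cases "m = 0"; cases "n = 0") (auto simp: enc_nat_simps)
  next
    case False
    then have "enc_nat m = enc_nat n \<longleftrightarrow> (odd m \<longleftrightarrow> odd n) \<and> m div 2 = n div 2"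
      using less[of "m div 2" "n div 2"] by (simp add: enc_nat_simps)
    also have "\<dots> \<longleftrightarrow> m = n" by (metis bit_eq_rec)
    finally show ?thesis .
  qed
qed

lemma dsucc_enc_nat: "dsucc (enc_nat n) = enc_nat (Suc n)"
proof (induction n rule: less_induct)
  case (less n)
  show ?case
  proof (cases "n = 0")
    case True
    then show ?thesis by (simp add: enc_nat_simps enc_bool_def)
  next
    case False
    then show ?thesis
      using less[of "n div 2"] by (cases "odd n") (simp_all add: enc_nat_simps enc_bool_def)
  qed
qed

lemma dcount_enc_list: "dcount (enc_list f xs) = enc_nat (length xs)"
  by (induction xs) (auto simp: enc_nat_simps(1) dsucc_enc_nat)

lemma enc_list_eq_Leaf [simp]: "enc_list f xs = Leaf \<longleftrightarrow> xs = []"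
  by (cases xs) auto

lemma right_enc_list: "right (enc_list f xs) = enc_list f (tl xs)"
  by (cases xs) auto

lemma left_enc_list: "xs \<noteq> [] \<Longrightarrow> left (enc_list f xs) = f (hd xs)"
  by (cases xs) auto

lemma dmap_enc_list: "dmap g (enc_list f xs) = enc_list (\<lambda>x. g (f x)) xs"
  by (induction xs) auto

lemma dappend_enc_list: "dappend (enc_list f xs) (enc_list f ys) = enc_list f (xs @ ys)"
  by (induction xs) auto

lemma dmem_enc_list: "dmem (enc_nat a) (enc_list enc_nat xs) = enc_bool (a \<in> set xs)"
  by (induction xs) (auto simp: enc_bool_def)

lemma dcover_enc_list: "dcover (enc_list (enc_prod enc_nat enc_nat) xs) = enc_list enc_nat (cover xs)"
  by (induction xs rule: cover.induct) (auto simp: dmem_enc_list)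

abbreviation (input) "enc_path \<equiv> enc_list enc_nat"
abbreviation (input) "enc_paths \<equiv> enc_list (enc_list enc_nat)"
abbreviation (input) "enc_edges \<equiv> enc_list (enc_prod enc_nat enc_nat)"

text \<open>An empty path would be encoded as \<open>Leaf\<close>, whose left part is again
  \<open>Leaf\<close>, the code of 0; the lookup would take it for a path starting at 0.\<close>

lemma dlookup_enc: "[] \<notin> set R \<Longrightarrow> dlookup (enc_nat a) (enc_paths R) = enc_path (lookup a R)"
  by (induction R) (auto simp: left_enc_list)

lemma drelax_enc:
  "[] \<notin> set R \<Longrightarrow> [] \<notin> set acc \<Longrightarrow>
    drelax (enc_paths R) (enc_nat a) (enc_nat b) (enc_paths acc) = enc_paths (relax R a b acc)"
  by (simp add: drelax_def relax_def dlookup_enc)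

lemma Nil_notin_step: "[] \<notin> set R \<Longrightarrow> [] \<notin> set (step R es)"
  using set_step[of R es] by blast

lemma dstep_enc: "[] \<notin> set R \<Longrightarrow> dstep (enc_paths R) (enc_edges es) = enc_paths (step R es)"
  by (induction R es rule: step.induct) (auto simp: drelax_enc Nil_notin_step set_relax)

lemma Nil_notin_bfs: "[] \<notin> set (bfs u es vs)"
  by (induction vs) (auto simp: Nil_notin_step)

lemma dbfs_enc:
  "dbfs (Node (enc_nat u) (enc_edges es)) (enc_list enc_nat vs) = enc_paths (bfs u es vs)"
  by (induction vs) (auto simp: dstep_enc Nil_notin_bfs)

lemma dlookup_dbfs_enc:
  "dlookup (enc_nat t) (dbfs (Node (enc_nat u) (enc_edges es)) (enc_list enc_nat vs)) =
    enc_path (path_to es vs t u)"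
  by (simp add: dbfs_enc dlookup_enc Nil_notin_bfs path_to_def)

lemma dconcat_enc:
  "dconcat (Node (enc_edges es) (enc_list enc_nat vs)) (enc_list enc_nat T) =
    enc_path (tour_walk (path_to es vs) T)"
  by (induction T) (auto simp: left_enc_list right_enc_list dlookup_dbfs_enc dappend_enc_list)

lemma enc_rat_of_nat: "enc_rat (of_nat n) = Node (Node Leaf (enc_nat n)) (enc_int 1)"
proof -
  have "quotient_of (of_nat n) = (int n, 1)"
    using quotient_of_int[of "int n"] by simp
  then show ?thesis by (simp add: enc_rat_def enc_int_def)
qed

text \<open>Row \<open>u\<close> comes from a search started at \<open>u\<close>, so its entry for
  \<open>v\<close> measures a path from \<open>v\<close> to \<open>u\<close>; symmetry of the
  distance reconciles the order in \<open>dmatrix_star_tsp\<close>.\<close>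

lemma dmatrix_enc:
  "dmatrix (Node (enc_list enc_nat cs) (Node (enc_edges es) (enc_list enc_nat vs))) (enc_list enc_nat cs) =
    enc_list (enc_list enc_rat)
      (map (\<lambda>u. map (\<lambda>v. of_nat (walk_length (path_to es vs v u))) cs) cs)"
proof -
  have map: "enc_list f (map g xs) = enc_list (\<lambda>x. f (g x)) xs" for f :: "'c \<Rightarrow> data" and g :: "'b \<Rightarrow> 'c" and xs
    by (induction xs) auto
  show ?thesis
    unfolding dmatrix_def drow_def
    by (simp add: dmap_enc_list map dlookup_dbfs_enc right_enc_list dcount_enc_list enc_rat_of_nat walk_length_def)
qed

section \<open>Output and running time of the algorithm\<close>

fun star_points :: "star_instance \<Rightarrow> nat list" where
  "star_points (vs, es, xs) = cover xs"

definition star_tsp :: "star_instance \<Rightarrow> tsp_instance" where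
  "star_tsp I = (star_points I, \<lambda>u v. of_nat (graph_dist (star_G I) u v))"

fun star_output :: "(tsp_instance \<Rightarrow> nat list) \<Rightarrow> star_instance \<Rightarrow> nat list" where
  "star_output A (vs, es, xs) = tour_walk (path_to es vs) (A (star_tsp (vs, es, xs)))"

lemma star_points_matching:
  assumes "I \<in> nonstar_instances"
  shows "distinct (star_points I)"
    and "\<exists>M. maximal_matching (edge_induced (star_X I)) M \<and> set (star_points I) = \<Union>M"
proof -
  obtain vs es xs where I: "I = (vs, es, xs)" by (cases I) auto
  have "card e = 2" if "e \<in> undirected xs" for e
    using assms that by (auto simp: I nonstar_instances_def star_instances_def simple_graph_def)
  from cover_maximal_matching[OF this] show "distinct (star_points I)"
    "\<exists>M. maximal_matching (edge_induced (star_X I)) M \<and> set (star_points I) = \<Union>M"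
    by (auto simp: I)
qed

lemma star_tsp_metric: "I \<in> nonstar_instances \<Longrightarrow> star_tsp I \<in> metric_tsp"
  using nonstar_instance(1) star_points_matching unfolding star_tsp_def by metis

text \<open>Some cycle passes through all points, so they are connected to each other even if the
  graph is not.\<close>

lemma path_to_star_points:
  assumes I: "I = (vs, es, xs)" "I \<in> nonstar_instances"
    and "u \<in> set (star_points I)" "v \<in> set (star_points I)"
  shows "shortest_path (star_G I) u v (path_to es vs u v)"
proof -
  obtain M where "maximal_matching (edge_induced (star_X I)) M" "set (star_points I) = \<Union>M"
    using star_points_matching(2)[OF I(2)] by blast
  from nonstar_instance(4)[OF I(2) this(1) star_points_matching(1)[OF I(2)] this(2)]
  obtain W where W: "cycle (star_G I) W" "set (star_points I) \<subseteq> set W" by (elim exE conjE)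
  then obtain q where "walk_betw (star_G I) u v q"
    using walk_connected[of "star_G I" W u v] assms(3,4) by (auto simp: cycle_def)
  then show ?thesis
    using path_to_shortest[of vs es u v q] I by (auto simp: nonstar_instances_def star_instances_def)
qed


lemma star_output_correct:
  assumes A: "tsp_approximation \<alpha> A" and I: "I \<in> nonstar_instances"
  shows "star_algorithm A I (star_output A I)"
proof -
  obtain vs es xs where Ieq: "I = (vs, es, xs)" by (cases I) auto
  let ?T = "A (star_tsp I)" and ?C = "set (star_points I)"
  obtain M where M: "maximal_matching (edge_induced (star_X I)) M" "?C = \<Union>M"
    using star_points_matching(2)[OF I] by blast
  have "hamiltonian_cycle ?C ?T"
    using A star_tsp_metric[OF I] by (auto simp: tsp_approximation_def star_tsp_def)
  then obtain ts where ts: "ts \<noteq> []" "set ts = ?C" "?T = ts @ [hd ts]"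
    by (auto simp: hamiltonian_cycle_def)
  have T: "set ?T = ?C" unfolding ts(3) using ts(1) by (simp add: ts(2)[symmetric] insert_absorb)
  have len: "2 \<le> length ?T" unfolding ts(3) using ts(1) by (cases ts) auto
  let ?Ss = "segments (path_to es vs) ?T"
  have path: "shortest_path (star_G I) (?T ! i) (?T ! Suc i) (path_to es vs (?T ! i) (?T ! Suc i))"
    if "Suc i < length ?T" for i
    using path_to_star_points[OF Ieq I] nth_mem[of i ?T] nth_mem[of "Suc i" ?T] that T by simp
  have "star_output A I = concat_walks ?Ss"
    unfolding Ieq star_output.simps
    by (rule tour_walk_concat_walks)
      (use path len in \<open>auto simp: Ieq shortest_path_def walk_betw_def walk_def\<close>)
  moreover have "length ?Ss = length ?T - 1" by simp
  moreover have "shortest_path (star_G I) (?T ! i) (?T ! Suc i) (?Ss ! i)" if "i < length ?Ss" for i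
    using path[of i] that by (simp add: nth_tl)
  moreover have "distinct (star_points I)" by (rule star_points_matching(1)[OF I])
  ultimately show ?thesis
    unfolding star_algorithm_def
    by (intro exI[of _ M] exI[of _ "star_points I"] exI[of _ ?T] exI[of _ ?Ss])
      (use M in \<open>auto simp: star_tsp_def\<close>)
qed

text \<open>The encodings agree although the distance functions may differ elsewhere: the matrix
  lists only pairs of points of the cover, and for these the stored paths are shortest.\<close>

lemma dmatrix_star_tsp:
  assumes I: "I = (vs, es, xs)" "I \<in> nonstar_instances"
  shows "enc_tsp (star_tsp I) = (let cs = enc_list enc_nat (cover xs) in
    Node cs (dmatrix (Node cs (Node (enc_edges es) (enc_list enc_nat vs))) cs))"
proof -
  have "graph_dist (star_G I) u v = walk_length (path_to es vs v u)"
    if "u \<in> set (cover xs)" "v \<in> set (cover xs)" for u v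
    using shortest_path_graph_dist[OF path_to_star_points[OF I, of v u]] that
    by (simp add: I(1) graph_dist_commute[of _ u v])
  then show ?thesis
    by (simp add: star_tsp_def Let_def dmatrix_enc I(1) cong: map_cong)
qed

lemma ptime_star_output:
  assumes A: "polynomial_time_on metric_tsp enc_tsp (enc_list enc_nat) A"
  shows "polynomial_time_on nonstar_instances enc_star (enc_list enc_nat) (star_output A)"
proof -
  let ?D = nonstar_instances
  let ?es = "\<lambda>I. left (right (enc_star I))" and ?vs = "\<lambda>I. left (enc_star I)"
    and ?cs = "\<lambda>I. dcover (right (right (enc_star I)))"
  let ?T = "\<lambda>I. enc_list enc_nat (A (star_tsp I))"
  have enc: "enc_star (vs, es, xs) = Node (enc_list enc_nat vs) (Node (enc_edges es) (enc_edges xs))"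
    for vs es xs by (simp add: enc_star_def)
  have cs: "ptime ?D enc_star ?cs"
    by (intro ptime2_comp[OF ptime2_dcover, where f = "\<lambda>_. Leaf"] ptime_intros)
  have "ptime ?D enc_star (\<lambda>I. Node (?cs I) (dmatrix (Node (?cs I) (Node (?es I) (?vs I))) (?cs I)))"
    by (intro ptime2_comp[OF ptime2_dmatrix] ptime_Node cs ptime_left ptime_right ptime_id)
  moreover have "enc_tsp (star_tsp I) = Node (?cs I) (dmatrix (Node (?cs I) (Node (?es I) (?vs I))) (?cs I))"
    if "I \<in> ?D" for I
    using dmatrix_star_tsp[OF _ that] by (cases I) (simp add: enc dcover_enc_list Let_def)
  ultimately have 1: "ptime ?D enc_star (\<lambda>I. enc_tsp (star_tsp I))"
    unfolding polynomial_time_on_def by simp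
  \<comment> \<open>The encoded TSP instance takes the role of the input encoding;
    \<open>star_tsp_metric\<close> places it in the domain on which \<open>A\<close> is
    efficient.\<close>
  have "ptime ?D (\<lambda>I. enc_tsp (star_tsp I)) ?T"
    using A star_tsp_metric unfolding polynomial_time_on_def by meson
  then have 2: "ptime ?D enc_star ?T" by (rule ptime_comp[OF 1])
  have "ptime ?D enc_star (\<lambda>I. dconcat (Node (?es I) (?vs I)) (?T I))"
    by (intro ptime2_comp[OF ptime2_dconcat] ptime_Node 2 ptime_left ptime_right ptime_id)
  moreover have "dconcat (Node (?es I) (?vs I)) (?T I) = enc_list enc_nat (star_output A I)" for I
    by (cases I) (simp add: enc dconcat_enc)
  ultimately show ?thesis unfolding polynomial_time_on_def by simp
qed

text \<open>Matching, listing and shortest paths are left open by the algorithm, so the guarantee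
  covers every output of the relation, while polynomial time concerns one way of resolving these
  choices, namely \<open>star_output A\<close>.\<close>

theorem theorem4:
  fixes A :: "tsp_instance \<Rightarrow> nat list" and \<alpha> :: real
  assumes "tsp_approximation \<alpha> A"
    and "polynomial_time_on metric_tsp enc_tsp (enc_list enc_nat) A"
  shows "(\<forall>I\<in>nonstar_instances. \<forall>S. star_algorithm A I S \<longrightarrow>
            cycle (star_G I) S \<and> covers S (star_X I) \<and>
            real (walk_length S) \<le> 3 * \<alpha> * real (star_opt (star_G I) (star_X I))) \<and>
         (\<exists>F. (\<forall>I\<in>nonstar_instances. star_algorithm A I (F I)) \<and>
            polynomial_time_on nonstar_instances enc_star (enc_list enc_nat) F)"
  using star_algorithm_correct[OF assms(1)] star_output_correct[OF assms(1)]
    ptime_star_output[OF assms(2)]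
  by blast

end
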